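(* There exist absolute constants $\beta_1,\beta_2>0$ and $H_0,\tilde C>0$ such that the following holds. Let the penalty $\mathrm{Pen}(n,J,K)$ be either $\mathrm{Pen}^{(s)}$ or $\mathrm{Pen}^{(ns)}$ (defined in the context) with these constants $\beta_1,\beta_2$. Let $(\hat\Theta,\hat Z,\hat J,\hat K)$ be a solution of the optimization problem $$\min_{\Theta,Z,J,K}\Big\{\sum_{k,l=1}^K\big\|A^{(k,l)}(Z,K)-\Theta^{(k,l)}\big\|_F^2+\mathrm{Pen}(n,J,K)\Big\}$$ over $K\in\{1,\dots,n\}$, $Z\in\mathcal M_{n,K}$, sparsity families $J=(J_{k,l})_{k,l=1}^K$ for $(Z,K)$, and block matrices $\Theta$ with blocks $\Theta^{(k,l)}\in\mathbb R^{n_k\times n_l}$ satisfying $\mathrm{supp}(\Theta^{(k,l)})=J_{k,l}\times J_{l,k}$ and $\mathrm{rank}(\Theta^{(k,l)})=1$ for all $k,l$. Define $\hat P=\mathscr P_{\hat Z,\hat K}\,\hat\Theta\,\mathscr P_{\hat Z,\hat K}^T$. Then for every $t>0$, $$\mathbb P\Big\{n^{-2}\|\hat P-P_*\|_F^2\le n^{-2}H_0\,\mathrm{Pen}(n,J_*,K_* )+n^{-2}\tilde C\,t\Big\}\ge 1-3e^{-t},$$ and $$n^{-2}\,\mathbb E\|\hat P-P_*\|_F^2\le n^{-2}H_0\,\mathrm{Pen}(n,J_*,K_* )+3n^{-2}\tilde C .$$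
   Context: Network model: $A\in\{0,1\}^{n\times n}$ is a symmetric adjacency matrix with $A_{ij}\sim\mathrm{Bernoulli}((P_* )_{ij})$ independent for $1\le i\le j\le n$, $A_{ji}=A_{ij}$, and $P_*$ symmetric. Clustering matrices: $\mathcal M_{n,K}$ is the set of $Z\in\{0,1\}^{n\times K}$ with exactly one $1$ in each row, $Z_{ik}=1$ iff node $i$ is in community $\mathcal N_k$, and $Z^TZ=\mathrm{diag}(n_1,\dots,n_K)$ with $n_k=|\mathcal N_k|$. $\mathscr P_{Z,K}$ is the $n\times n$ permutation matrix reordering nodes so that nodes of community 1 come first, then community 2, etc.; for $B\in\mathbb R^{n\times n}$, $B(Z,K)=\mathscr P_{Z,K}^TB\mathscr P_{Z,K}$ and $B^{(k,l)}(Z,K)\in\mathbb R^{n_k\times n_l}$ is its $(k,l)$ block (rows indexed by nodes of $\mathcal N_k$, columns by nodes of $\mathcal N_l$). Sparse popularity adjusted block model: there are $K_*$, $Z_*\in\mathcal M_{n,K_*}$ with community sizes $n_k$, and a matrix $\Lambda_*\in[0,1]^{n\times K_*}$ whose column $l$ is split into blocks $\Lambda_*^{(k,l)}\in[0,1]^{n_k}$ (entries indexed by nodes in community $k$), such that $P_*^{(k,l)}(Z_*,K_* )=\Lambda_*^{(k,l)}(\Lambda_*^{(l,k)})^T$ for all $k,l$. Let $(J_* )_{k,l}=\{i\in\mathcal N_k:(\Lambda_*^{(k,l)})_i\neq 0\}$ and $J_*=(J_* )_{k,l}$, $k,l=1,\dots,K_*$, i.e. the set of positions of nonzero entries of $\Lambda_*$,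 with $|J_*|=\sum_{k,l}|(J_* )_{k,l}|$. Sparsity family: for $(Z,K)$, a family $J=(J_{k,l})_{k,l=1}^K$ with $J_{k,l}\subseteq\mathcal N_k$; $|J|=\sum_{k,l}|J_{k,l}|$. Penalties (with convention $0\cdot\ln(c/0)=0$): $\mathrm{Pen}^{(s)}(n,J,K)=\beta_1\sum_{k,l=1}^K|J_{k,l}|\ln(n_ke/|J_{k,l}|)+\beta_2K\sum_{k=1}^K\ln n_k+\beta_2(n\ln K+\ln n)$; $\mathrm{Pen}^{(ns)}(n,J,K)=\beta_1|J|\ln(nKe/|J|)+2\beta_2\ln n+\beta_2(n\ln K+\ln n)$. In $\mathrm{Pen}(n,J_*,K_* )$ the community sizes are those of $Z_*$.
   Formalization: The constraint rank(Θ^{(k,l)})=1 is read as rank at most 1, so blocks with empty J_{k,l} may be zero (with exact rank 1 there is no minimizer when A=0); all communities of Z and Z_* are required to be nonempty so that ln n_k is defined. *)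

theory Defs
  imports "HOL-Probability.Probability"
begin

(* Nodes are 0..<n, communities are 0..<K.  A clustering Z in M_{n,K} is given by
   its label function z (node i is in community z i), i.e. Z_{ik} = 1 iff z i = k. *)

definition community :: "nat \<Rightarrow> (nat \<Rightarrow> nat) \<Rightarrow> nat \<Rightarrow> nat set" where
  "community n z k = {i. i < n \<and> z i = k}"

definition clustering :: "nat \<Rightarrow> nat \<Rightarrow> (nat \<Rightarrow> nat) \<Rightarrow> bool" where
  "clustering n K z \<longleftrightarrow> (\<forall>i<n. z i < K) \<and> (\<forall>k<K. community n z k \<noteq> {})"

definition sparsity_family :: "nat \<Rightarrow> (nat \<Rightarrow> nat) \<Rightarrow> nat \<Rightarrow> (nat \<Rightarrow> nat \<Rightarrow> nat set) \<Rightarrow> bool" where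
  "sparsity_family n z K J \<longleftrightarrow> (\<forall>k<K. \<forall>l<K. J k l \<subseteq> community n z k)"

definition card_family :: "nat \<Rightarrow> (nat \<Rightarrow> nat \<Rightarrow> nat set) \<Rightarrow> nat" where
  "card_family K J = (\<Sum>k<K. \<Sum>l<K. card (J k l))"

definition xln :: "nat \<Rightarrow> real \<Rightarrow> real" where
  "xln m c = (if m = 0 then 0 else real m * ln (c / real m))"

definition pen_s :: "real \<Rightarrow> real \<Rightarrow> nat \<Rightarrow> (nat \<Rightarrow> nat) \<Rightarrow> nat \<Rightarrow> (nat \<Rightarrow> nat \<Rightarrow> nat set) \<Rightarrow> real" where
  "pen_s \<beta>1 \<beta>2 n z K J =
     \<beta>1 * (\<Sum>k<K. \<Sum>l<K. xln (card (J k l)) (real (card (community n z k)) * exp 1))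
     + \<beta>2 * real K * (\<Sum>k<K. ln (real (card (community n z k))))
     + \<beta>2 * (real n * ln (real K) + ln (real n))"

definition pen_ns :: "real \<Rightarrow> real \<Rightarrow> nat \<Rightarrow> (nat \<Rightarrow> nat) \<Rightarrow> nat \<Rightarrow> (nat \<Rightarrow> nat \<Rightarrow> nat set) \<Rightarrow> real" where
  "pen_ns \<beta>1 \<beta>2 n z K J =
     \<beta>1 * xln (card_family K J) (real n * real K * exp 1)
     + 2 * \<beta>2 * ln (real n)
     + \<beta>2 * (real n * ln (real K) + ln (real n))"

definition pen :: "bool \<Rightarrow> real \<Rightarrow> real \<Rightarrow> nat \<Rightarrow> (nat \<Rightarrow> nat) \<Rightarrow> nat \<Rightarrow> (nat \<Rightarrow> nat \<Rightarrow> nat set) \<Rightarrow> real" where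
  "pen is_sp \<beta>1 \<beta>2 = (if is_sp then pen_s \<beta>1 \<beta>2 else pen_ns \<beta>1 \<beta>2)"

definition block_constraint :: "nat \<Rightarrow> (nat \<Rightarrow> nat) \<Rightarrow> nat \<Rightarrow> (nat \<Rightarrow> nat \<Rightarrow> nat set)
    \<Rightarrow> (nat \<Rightarrow> nat \<Rightarrow> real) \<Rightarrow> bool" where
  "block_constraint n z K J \<Theta> \<longleftrightarrow>
     (\<forall>k<K. \<forall>l<K.
        (\<forall>i\<in>community n z k. \<forall>j\<in>community n z l. \<Theta> i j \<noteq> 0 \<longleftrightarrow> i \<in> J k l \<and> j \<in> J l k)
      \<and> (\<exists>u v :: nat \<Rightarrow> real. \<forall>i\<in>community n z k. \<forall>j\<in>community n z l. \<Theta> i j = u i * v j))"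

type_synonym candidate = "(nat \<Rightarrow> nat \<Rightarrow> real) \<times> (nat \<Rightarrow> nat) \<times> (nat \<Rightarrow> nat \<Rightarrow> nat set) \<times> nat"

definition feasible :: "nat \<Rightarrow> candidate \<Rightarrow> bool" where
  "feasible n c = (case c of (\<Theta>, z, J, K) \<Rightarrow>
     1 \<le> K \<and> K \<le> n \<and> clustering n K z \<and> sparsity_family n z K J \<and> block_constraint n z K J \<Theta>)"

definition objective :: "bool \<Rightarrow> real \<Rightarrow> real \<Rightarrow> nat \<Rightarrow> (nat \<Rightarrow> nat \<Rightarrow> real) \<Rightarrow> candidate \<Rightarrow> real" where
  "objective is_sp \<beta>1 \<beta>2 n A c = (case c of (\<Theta>, z, J, K) \<Rightarrow>
     (\<Sum>k<K. \<Sum>l<K. \<Sum>i\<in>community n z k. \<Sum>j\<in>community n z l. (A i j - \<Theta> i j)\<^sup>2)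
     + pen is_sp \<beta>1 \<beta>2 n z K J)"

definition is_solution :: "bool \<Rightarrow> real \<Rightarrow> real \<Rightarrow> nat \<Rightarrow> (nat \<Rightarrow> nat \<Rightarrow> real) \<Rightarrow> candidate \<Rightarrow> bool" where
  "is_solution is_sp \<beta>1 \<beta>2 n A c \<longleftrightarrow>
     feasible n c \<and> (\<forall>c'. feasible n c' \<longrightarrow> objective is_sp \<beta>1 \<beta>2 n A c \<le> objective is_sp \<beta>1 \<beta>2 n A c')"

definition frob_sq :: "nat \<Rightarrow> (nat \<Rightarrow> nat \<Rightarrow> real) \<Rightarrow> (nat \<Rightarrow> nat \<Rightarrow> real) \<Rightarrow> real" where
  "frob_sq n M N = (\<Sum>i<n. \<Sum>j<n. (M i j - N i j)\<^sup>2)"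

(* distribution of the adjacency matrix: independent A_{ij} ~ Bernoulli(P_{ij}) for i <= j < n,
   A_{ji} = A_{ij}; entries outside the n x n index set are 0 *)
definition adj_pmf :: "nat \<Rightarrow> (nat \<Rightarrow> nat \<Rightarrow> real) \<Rightarrow> (nat \<Rightarrow> nat \<Rightarrow> real) pmf" where
  "adj_pmf n P = map_pmf (\<lambda>e i j. if e (min i j, max i j) then 1 else 0)
      (Pi_pmf {(i, j). i \<le> j \<and> j < n} False (\<lambda>(i, j). bernoulli_pmf (P i j)))"

(* (Jstar)_{k,l} = { i in N_k : Lambda i l <> 0 }, where (Lambda^{(k,l)})_i = Lambda i l *)
definition Jstar :: "nat \<Rightarrow> (nat \<Rightarrow> nat) \<Rightarrow> (nat \<Rightarrow> nat \<Rightarrow> real) \<Rightarrow> nat \<Rightarrow> nat \<Rightarrow> nat set" where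
  "Jstar n z \<Lambda> k l = {i \<in> community n z k. \<Lambda> i l \<noteq> 0}"

end

(* Let Xi = A - P. Comparing the minimiser with the true parameters gives
   |Theta - P|^2 <= 2 <Xi, Theta - P> + Pen(true) - Pen(selected), so the noise term has to be
   bounded uniformly over all models. For every selected (Z, J, K) fix as a centre the closest
   estimate to P that ever occurs with this model; on each block the difference of Theta and the
   centre has rank at most two, hence is a sum of two orthogonal rank-one matrices by Gram-Schmidt.
   Since <Xi, u v^T> is linear in u and in v, suitably scaled u and v can be rounded to integer
   vectors, up or down by the sign of the coefficient, without decreasing it. What remains is a
   countable family of fixed matrices, each with a sub-Gaussian exponential moment (Hoeffding's
   lemma), and the weights exp(- delta |x|) of the integer vectors together with exp(- Pen) of the
   models are summable. This bounds E exp((|Theta - P|^2 - 2 Pen) / 800) by 2, whence both claims.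

   With the separate penalty, communities of a single node have ln n_k = 0, so their supports are
   not paid for in the union bound. Minimality helps: for beta_1 >= 2, J_kl is empty when J_lk is,
   and also when both communities are singletons, so the supports are determined by the rows
   that belong to communities with at least two nodes. *)
theory Submission
  imports Defs
begin

subsection \<open>Rounding matrices of rank at most two\<close>

lemma square_add_le: "((a::real) + b)\<^sup>2 \<le> 2 * a\<^sup>2 + 2 * b\<^sup>2"
  using sum_squares_bound[of a b] by (simp add: power2_sum)

text \<open>The rounding direction follows the sign of the coefficient \<open>c\<close>, so that a
  linear form with that coefficient cannot decrease.\<close>

definition rnd :: "real \<Rightarrow> real \<Rightarrow> int" where
  "rnd c x = (if 0 \<le> c then \<lceil>x\<rceil> else \<lfloor>x\<rfloor>)"

lemma rnd_ge: "c * x \<le> c * of_int (rnd c x)"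
  by (auto simp: rnd_def intro: mult_left_mono mult_left_mono_neg)

lemma rnd_square_le: "(of_int (rnd c x))\<^sup>2 \<le> 2 * x\<^sup>2 + 2"
proof -
  define d where "d = of_int (rnd c x) - x"
  have "\<bar>d\<bar> \<le> 1" unfolding d_def rnd_def by (auto; linarith)
  then have d: "d\<^sup>2 \<le> 1" by (simp add: abs_square_le_1)
  have "(of_int (rnd c x))\<^sup>2 = (x + d)\<^sup>2" by (simp add: d_def)
  also have "\<dots> \<le> 2 * x\<^sup>2 + 2 * d\<^sup>2"
    by (rule square_add_le)
  finally show ?thesis using d by simp
qed

lemma sum_rnd_square_le:
  "(\<Sum>i\<in>I. (of_int (rnd (c i) (u i)))\<^sup>2) \<le> 2 * (\<Sum>i\<in>I. (u i)\<^sup>2) + 2 * real (card I)"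
proof -
  have "(\<Sum>i\<in>I. (of_int (rnd (c i) (u i)))\<^sup>2) \<le> (\<Sum>i\<in>I. 2 * (u i)\<^sup>2 + 2)"
    by (intro sum_mono rnd_square_le)
  then show ?thesis by (simp add: sum.distrib sum_distrib_left)
qed

text \<open>The form is linear in each vector, so \<open>u\<close> is rounded first with
  \<open>v\<close> fixed, then \<open>v\<close> with the rounded \<open>x\<close> fixed. Before
  that, the scale is moved so that the column vector has squared norm \<open>card J\<close>: its
  rounding then costs only a constant factor, and the row vector carries the whole Frobenius norm.
  The factor \<open>1 / sqrt (card J)\<close> undoes the scaling.\<close>

lemma rank_one_round:
  fixes u :: "'a \<Rightarrow> real" and v :: "'b \<Rightarrow> real" and \<Xi> :: "'a \<Rightarrow> 'b \<Rightarrow> real"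
  assumes "finite I" "finite J"
  obtains x :: "'a \<Rightarrow> int" and y :: "'b \<Rightarrow> int"
  where "(\<Sum>i\<in>I. \<Sum>j\<in>J. \<Xi> i j * (u i * v j))
           \<le> (\<Sum>i\<in>I. \<Sum>j\<in>J. \<Xi> i j * (of_int (x i) * of_int (y j) / sqrt (card J)))"
    and "(\<Sum>i\<in>I. (of_int (x i))\<^sup>2) \<le> 2 * ((\<Sum>i\<in>I. (u i)\<^sup>2) * (\<Sum>j\<in>J. (v j)\<^sup>2)) + 2 * real (card I)"
    and "(\<Sum>j\<in>J. (of_int (y j))\<^sup>2) \<le> 4 * real (card J)"
proof (cases "(\<Sum>j\<in>J. (v j)\<^sup>2) = 0")
  case True
  then have "\<forall>j\<in>J. v j = 0" using assms by (simp add: sum_nonneg_eq_0_iff)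
  \<comment> \<open>Nothing can be normalised here, but the form vanishes, so zero vectors do; this
    covers empty \<open>J\<close> as well.\<close>
  then show ?thesis using that[of "\<lambda>_. 0" "\<lambda>_. 0"] by simp
next
  case False
  define b where "b = (\<Sum>j\<in>J. (v j)\<^sup>2)"
  have b: "b > 0" using False unfolding b_def by (simp add: less_le sum_nonneg)
  then have "J \<noteq> {}" by (auto simp: b_def)
  then have m: "real (card J) > 0" using assms by (simp add: card_gt_0_iff)
  define u' where "u' i = u i * sqrt b" for i
  define v' where "v' j = v j * sqrt (card J) / sqrt b" for j
  \<comment> \<open>Each rounding uses the coefficients given by the current state of the other
    factor: the unrounded \<open>v'\<close> for \<open>x\<close>, the already rounded
    \<open>x\<close> for \<open>y\<close>.\<close>
  define x where "x i = rnd (\<Sum>j\<in>J. \<Xi> i j * v' j / sqrt (card J)) (u' i)" for i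
  define y where "y j = rnd (\<Sum>i\<in>I. \<Xi> i j * of_int (x i) / sqrt (card J)) (v' j)" for j
  have "(\<Sum>i\<in>I. \<Sum>j\<in>J. \<Xi> i j * (u i * v j)) = (\<Sum>i\<in>I. \<Sum>j\<in>J. \<Xi> i j * v' j / sqrt (card J) * u' i)"
    using b m by (intro sum.cong refl) (simp add: u'_def v'_def)
  also have "\<dots> = (\<Sum>i\<in>I. (\<Sum>j\<in>J. \<Xi> i j * v' j / sqrt (card J)) * u' i)"
    by (simp add: sum_distrib_right)
  also have "\<dots> \<le> (\<Sum>i\<in>I. (\<Sum>j\<in>J. \<Xi> i j * v' j / sqrt (card J)) * of_int (x i))"
    unfolding x_def by (intro sum_mono rnd_ge)
  also have "\<dots> = (\<Sum>j\<in>J. (\<Sum>i\<in>I. \<Xi> i j * of_int (x i) / sqrt (card J)) * v' j)"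
    unfolding sum_distrib_right by (subst sum.swap) (simp add: mult_ac)
  also have "\<dots> \<le> (\<Sum>j\<in>J. (\<Sum>i\<in>I. \<Xi> i j * of_int (x i) / sqrt (card J)) * of_int (y j))"
    unfolding y_def by (intro sum_mono rnd_ge)
  also have "\<dots> = (\<Sum>i\<in>I. \<Sum>j\<in>J. \<Xi> i j * (of_int (x i) * of_int (y j) / sqrt (card J)))"
    unfolding sum_distrib_right by (subst sum.swap) (simp add: mult_ac)
  finally have 1: "(\<Sum>i\<in>I. \<Sum>j\<in>J. \<Xi> i j * (u i * v j)) \<le> \<dots>" .
  have "(\<Sum>i\<in>I. (u' i)\<^sup>2) = (\<Sum>i\<in>I. (u i)\<^sup>2) * b"
    using b by (simp add: u'_def power_mult_distrib sum_distrib_right)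
  then have 2: "(\<Sum>i\<in>I. (of_int (x i))\<^sup>2) \<le> 2 * ((\<Sum>i\<in>I. (u i)\<^sup>2) * b) + 2 * real (card I)"
    using sum_rnd_square_le[of "\<lambda>i. \<Sum>j\<in>J. \<Xi> i j * v' j / sqrt (card J)" u' I] unfolding x_def by simp
  have "(\<Sum>j\<in>J. (v' j)\<^sup>2) = (\<Sum>j\<in>J. (v j)\<^sup>2 * (card J / b))"
    using b by (intro sum.cong refl) (simp add: v'_def power_mult_distrib power_divide)
  also have "\<dots> = b * (card J / b)" unfolding b_def by (rule sum_distrib_right[symmetric])
  also have "\<dots> = card J" using b by simp
  finally have 3: "(\<Sum>j\<in>J. (of_int (y j))\<^sup>2) \<le> 4 * real (card J)"
    using sum_rnd_square_le[of "\<lambda>j. \<Sum>i\<in>I. \<Xi> i j * of_int (x i) / sqrt (card J)" v' J] unfolding y_def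
    by linarith
  show ?thesis using that[OF 1 2[unfolded b_def] 3] .
qed

text \<open>Gram-Schmidt on the row vectors: \<open>w\<close> is \<open>u\<close> minus its
  projection onto \<open>u'\<close>, and \<open>q\<close> takes up the rest. Orthogonality of
  \<open>w\<close> and \<open>u'\<close> removes the cross term, so each rank-one piece is bounded
  by the norm of the difference, which need not hold for the original pair.\<close>

lemma rank_two_orthogonal:
  fixes u u' :: "'a \<Rightarrow> real" and v v' :: "'b \<Rightarrow> real"
  assumes "finite I" "finite J"
  obtains w :: "'a \<Rightarrow> real" and q :: "'b \<Rightarrow> real"
  where "\<And>i j. i \<in> I \<Longrightarrow> u i * v j - u' i * v' j = w i * v j + u' i * q j"
    and "(\<Sum>i\<in>I. (w i)\<^sup>2) * (\<Sum>j\<in>J. (v j)\<^sup>2) + (\<Sum>i\<in>I. (u' i)\<^sup>2) * (\<Sum>j\<in>J. (q j)\<^sup>2)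
           = (\<Sum>i\<in>I. \<Sum>j\<in>J. (u i * v j - u' i * v' j)\<^sup>2)"
proof -
  obtain c where c: "(\<Sum>i\<in>I. (u i - c * u' i) * u' i) = 0"
  proof (cases "(\<Sum>i\<in>I. (u' i)\<^sup>2) = 0")
    case True
    then have "\<forall>i\<in>I. u' i = 0" using assms by (simp add: sum_nonneg_eq_0_iff)
    \<comment> \<open>If \<open>u'\<close> vanishes, every coefficient makes the residual orthogonal
      to it.\<close>
    then show ?thesis using that[of 0] by simp
  next
    case False
    have e: "(\<Sum>i\<in>I. (u i - c * u' i) * u' i) = (\<Sum>i\<in>I. u i * u' i) - c * (\<Sum>i\<in>I. (u' i)\<^sup>2)" for c
      by (simp add: left_diff_distrib sum_subtractf sum_distrib_left power2_eq_square mult.assoc)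
    show ?thesis
      by (rule that[of "(\<Sum>i\<in>I. u i * u' i) / (\<Sum>i\<in>I. (u' i)\<^sup>2)"]) (use False in \<open>simp only: e, simp\<close>)
  qed
  define w where "w i = u i - c * u' i" for i
  define q where "q j = c * v j - v' j" for j
  have dec: "u i * v j - u' i * v' j = w i * v j + u' i * q j" for i j
    by (simp add: w_def q_def algebra_simps)
  have "(\<Sum>i\<in>I. \<Sum>j\<in>J. (u i * v j - u' i * v' j)\<^sup>2)
     = (\<Sum>i\<in>I. \<Sum>j\<in>J. (w i)\<^sup>2 * (v j)\<^sup>2 + (u' i)\<^sup>2 * (q j)\<^sup>2 + 2 * ((w i * u' i) * (v j * q j)))"
    unfolding dec by (intro sum.cong refl) (simp add: power2_eq_square algebra_simps)
  also have "\<dots> = (\<Sum>i\<in>I. (w i)\<^sup>2) * (\<Sum>j\<in>J. (v j)\<^sup>2) + (\<Sum>i\<in>I. (u' i)\<^sup>2) * (\<Sum>j\<in>J. (q j)\<^sup>2)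
      + 2 * ((\<Sum>i\<in>I. w i * u' i) * (\<Sum>j\<in>J. v j * q j))"
    by (simp only: sum.distrib sum_distrib_left[symmetric] sum_distrib_right[symmetric])
  finally show ?thesis using that[of w q] dec c by (simp add: w_def)
qed

text \<open>Both orthogonal summands are rounded separately. The second and third bounds limit the
  size of the integer code, which its weight must pay for; the last one limits the variance proxy of
  the resulting fixed matrix.\<close>

lemma rank_two_round:
  fixes u u' :: "'a \<Rightarrow> real" and v v' :: "'b \<Rightarrow> real" and \<Xi> :: "'a \<Rightarrow> 'b \<Rightarrow> real"
  assumes fin: "finite I" "finite J"
  defines "R \<equiv> (\<Sum>i\<in>I. \<Sum>j\<in>J. (u i * v j - u' i * v' j)\<^sup>2)"
  obtains x x' :: "'a \<Rightarrow> int" and y y' :: "'b \<Rightarrow> int"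
  where "(\<Sum>i\<in>I. \<Sum>j\<in>J. \<Xi> i j * (u i * v j - u' i * v' j))
           \<le> (\<Sum>i\<in>I. \<Sum>j\<in>J. \<Xi> i j * ((of_int (x i) * of_int (y j) + of_int (x' i) * of_int (y' j)) / sqrt (card J)))"
    and "(\<Sum>i\<in>I. (of_int (x i))\<^sup>2 + (of_int (x' i))\<^sup>2) \<le> 2 * R + 4 * real (card I)"
    and "(\<Sum>j\<in>J. (of_int (y j))\<^sup>2 + (of_int (y' j))\<^sup>2) \<le> 8 * real (card J)"
    and "(\<Sum>i\<in>I. \<Sum>j\<in>J. ((of_int (x i) * of_int (y j) + of_int (x' i) * of_int (y' j)) / sqrt (card J))\<^sup>2)
           \<le> 16 * R + 32 * real (card I)"
proof -
  obtain w q where wq: "\<And>i j. i \<in> I \<Longrightarrow> u i * v j - u' i * v' j = w i * v j + u' i * q j"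
    "(\<Sum>i\<in>I. (w i)\<^sup>2) * (\<Sum>j\<in>J. (v j)\<^sup>2) + (\<Sum>i\<in>I. (u' i)\<^sup>2) * (\<Sum>j\<in>J. (q j)\<^sup>2) = R"
    unfolding R_def by (rule rank_two_orthogonal[OF fin, of u v u' v']) blast
  obtain x y where xy: "(\<Sum>i\<in>I. \<Sum>j\<in>J. \<Xi> i j * (w i * v j))
           \<le> (\<Sum>i\<in>I. \<Sum>j\<in>J. \<Xi> i j * (of_int (x i) * of_int (y j) / sqrt (card J)))"
    "(\<Sum>i\<in>I. (of_int (x i))\<^sup>2) \<le> 2 * ((\<Sum>i\<in>I. (w i)\<^sup>2) * (\<Sum>j\<in>J. (v j)\<^sup>2)) + 2 * real (card I)"
    "(\<Sum>j\<in>J. (of_int (y j))\<^sup>2) \<le> 4 * real (card J)"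
    by (rule rank_one_round[OF fin])
  obtain x' y' where xy': "(\<Sum>i\<in>I. \<Sum>j\<in>J. \<Xi> i j * (u' i * q j))
           \<le> (\<Sum>i\<in>I. \<Sum>j\<in>J. \<Xi> i j * (of_int (x' i) * of_int (y' j) / sqrt (card J)))"
    "(\<Sum>i\<in>I. (of_int (x' i))\<^sup>2) \<le> 2 * ((\<Sum>i\<in>I. (u' i)\<^sup>2) * (\<Sum>j\<in>J. (q j)\<^sup>2)) + 2 * real (card I)"
    "(\<Sum>j\<in>J. (of_int (y' j))\<^sup>2) \<le> 4 * real (card J)"
    by (rule rank_one_round[OF fin])
  have "(\<Sum>i\<in>I. \<Sum>j\<in>J. \<Xi> i j * (u i * v j - u' i * v' j))
      = (\<Sum>i\<in>I. \<Sum>j\<in>J. \<Xi> i j * (w i * v j)) + (\<Sum>i\<in>I. \<Sum>j\<in>J. \<Xi> i j * (u' i * q j))"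
    by (simp add: wq(1) distrib_left sum.distrib)
  also have "\<dots> \<le> (\<Sum>i\<in>I. \<Sum>j\<in>J. \<Xi> i j * (of_int (x i) * of_int (y j) / sqrt (card J)))
      + (\<Sum>i\<in>I. \<Sum>j\<in>J. \<Xi> i j * (of_int (x' i) * of_int (y' j) / sqrt (card J)))"
    using xy xy' by simp
  also have "\<dots> = (\<Sum>i\<in>I. \<Sum>j\<in>J. \<Xi> i j * ((of_int (x i) * of_int (y j) + of_int (x' i) * of_int (y' j)) / sqrt (card J)))"
    by (simp add: distrib_left add_divide_distrib sum.distrib)
  finally have 1: "(\<Sum>i\<in>I. \<Sum>j\<in>J. \<Xi> i j * (u i * v j - u' i * v' j)) \<le> \<dots>" .
  have 2: "(\<Sum>i\<in>I. (of_int (x i))\<^sup>2 + (of_int (x' i))\<^sup>2) \<le> 2 * R + 4 * real (card I)"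
    using xy(2) xy'(2) wq(2) by (simp add: sum.distrib)
  have 3: "(\<Sum>j\<in>J. (of_int (y j))\<^sup>2 + (of_int (y' j))\<^sup>2) \<le> 8 * real (card J)"
    using xy(3) xy'(3) by (simp add: sum.distrib)
  have 4: "(\<Sum>i\<in>I. \<Sum>j\<in>J. ((of_int (x i) * of_int (y j) + of_int (x' i) * of_int (y' j)) / sqrt (card J))\<^sup>2)
           \<le> 16 * R + 32 * real (card I)"
  proof (cases "card J = 0")
    case True
    have "R \<ge> 0" unfolding R_def by (intro sum_nonneg) auto
    then show ?thesis using True by simp
  next
    case False
    let ?a = "\<Sum>i\<in>I. (of_int (x i) :: real)\<^sup>2" and ?a' = "\<Sum>i\<in>I. (of_int (x' i) :: real)\<^sup>2"
    let ?b = "\<Sum>j\<in>J. (of_int (y j) :: real)\<^sup>2" and ?b' = "\<Sum>j\<in>J. (of_int (y' j) :: real)\<^sup>2"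
    have "(\<Sum>i\<in>I. \<Sum>j\<in>J. ((of_int (x i) * of_int (y j) + of_int (x' i) * of_int (y' j)) / sqrt (card J))\<^sup>2)
        = (\<Sum>i\<in>I. \<Sum>j\<in>J. (of_int (x i) * of_int (y j) + of_int (x' i) * of_int (y' j))\<^sup>2) / card J"
      by (simp add: power_divide sum_divide_distrib)
    also have "\<dots> \<le> (\<Sum>i\<in>I. \<Sum>j\<in>J. 2 * ((of_int (x i))\<^sup>2 * (of_int (y j))\<^sup>2) + 2 * ((of_int (x' i))\<^sup>2 * (of_int (y' j))\<^sup>2)) / card J"
      by (intro divide_right_mono sum_mono order_trans[OF square_add_le]) (auto simp: power_mult_distrib)
    also have "\<dots> = (2 * (?a * ?b) + 2 * (?a' * ?b')) / card J"
      by (simp only: sum.distrib sum_distrib_left[symmetric] sum_distrib_right[symmetric])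
    \<comment> \<open>The column vectors have squared norm at most \<open>4 * card J\<close>, which
      cancels the normalisation.\<close>
    also have "\<dots> \<le> (2 * (?a * (4 * real (card J))) + 2 * (?a' * (4 * real (card J)))) / card J"
      using xy(3) xy'(3) by (intro divide_right_mono add_mono mult_left_mono) (auto intro: sum_nonneg)
    also have "\<dots> = 8 * (?a + ?a')" using False by (simp add: field_simps)
    also have "\<dots> \<le> 16 * R + 32 * real (card I)" using 2 by (simp add: sum.distrib)
    finally show ?thesis .
  qed
  show ?thesis by (rule that[OF 1 2 3 4])
qed

subsection \<open>Exponential moments of the adjacency matrix\<close>

text \<open>Hoeffding's lemma for a centred Bernoulli variable. A negative \<open>s\<close> is
  reduced to a positive one by exchanging \<open>p\<close> and \<open>1 - p\<close>.\<close>

lemma bernoulli_mgf: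
  fixes s p :: real
  assumes "0 \<le> p" "p \<le> 1"
  shows "p * exp (s * (1 - p)) + (1 - p) * exp (s * (0 - p)) \<le> exp (s\<^sup>2 / 8)"
proof -
  have pos: "r * exp (h * (1 - r)) + (1 - r) * exp (h * (0 - r)) \<le> exp (h\<^sup>2 / 8)"
    if "0 \<le> r" "r \<le> 1" "0 \<le> h" for r h :: real
  proof -
    have "0 \<le> r * (exp h - 1)" using that by simp
    then have g: "1 + r * (exp h - 1) > 0" by linarith
    have "r * exp (h * (1 - r)) + (1 - r) * exp (h * (0 - r)) = exp (- h * r) * (1 + r * (exp h - 1))"
      by (simp add: algebra_simps exp_diff exp_add exp_minus divide_inverse)
    also have "\<dots> = exp (- h * r + ln (1 + r * (exp h - 1)))"
      using g by (simp only: exp_add exp_ln)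
    also have "\<dots> \<le> exp (h\<^sup>2 / 8)"
      using Hoeffdings_lemma_aux[of h r] that by simp
    finally show ?thesis .
  qed
  show ?thesis
  proof (cases "0 \<le> s")
    case True
    then show ?thesis using pos assms by blast
  next
    case False
    then show ?thesis using pos[of "1 - p" "- s"] assms by (simp add: algebra_simps)
  qed
qed

section \<open>The law of the adjacency matrix\<close>

lemma finite_upper_pairs: "finite {(i, j). i \<le> j \<and> j < (n::nat)}"
  by (rule finite_subset[of _ "{..<n} \<times> {..<n}"]) auto

text \<open>Finite support makes every real function of \<open>A\<close> integrable, however the
  minimiser is selected, and leaves only finitely many models to consider.\<close>

lemma finite_set_adj_pmf: "finite (set_pmf (adj_pmf n P))"
proof -
  have "set_pmf (Pi_pmf {(i, j). i \<le> j \<and> j < n} False (\<lambda>(i, j). bernoulli_pmf (P i j)))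
      \<subseteq> PiE_dflt {(i, j). i \<le> j \<and> j < n} False (\<lambda>_. UNIV)"
    using finite_upper_pairs by (auto simp: set_Pi_pmf PiE_dflt_def)
  moreover have "finite (PiE_dflt {(i, j). i \<le> j \<and> j < n} False (\<lambda>_. UNIV :: bool set))"
    using finite_upper_pairs by (intro finite_PiE_dflt) auto
  ultimately show ?thesis by (auto simp: adj_pmf_def dest: finite_subset)
qed

lemma set_adj_pmf_values: "A \<in> set_pmf (adj_pmf n P) \<Longrightarrow> A i j = 0 \<or> A i j = 1"
  by (auto simp: adj_pmf_def)

text \<open>Represents the unordered pair whose Bernoulli variable determines the entry at
  \<open>e\<close>.\<close>

definition pair_sort :: "nat \<times> nat \<Rightarrow> nat \<times> nat" where
  "pair_sort e = (min (fst e) (snd e), max (fst e) (snd e))"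

lemma card_pair_sort_fiber: "card {x \<in> {..<n} \<times> {..<n}. pair_sort x = e} \<le> 2"
proof -
  have "{x \<in> {..<n} \<times> {..<n}. pair_sort x = e} \<subseteq> {e, (snd e, fst e)}"
    by (auto simp: pair_sort_def min_def max_def split: if_splits)
  then have "card {x \<in> {..<n} \<times> {..<n}. pair_sort x = e} \<le> card {e, (snd e, fst e)}"
    by (intro card_mono) auto
  also have "\<dots> \<le> 2" by (rule order_trans[OF card_insert_le_m1]) auto
  finally show ?thesis .
qed

text \<open>Entries \<open>(i, j)\<close> and \<open>(j, i)\<close> share one variable, so the form
  is regrouped into an independent sum over unordered pairs, to which Hoeffding's lemma applies
  factor by factor. Merging at most two coefficients costs a factor 2 and turns 1/8 into
  1/4.\<close>

lemma adj_pmf_mgf: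
  fixes P G :: "nat \<Rightarrow> nat \<Rightarrow> real"
  assumes P: "\<And>i j. i < n \<Longrightarrow> j < n \<Longrightarrow> 0 \<le> P i j \<and> P i j \<le> 1"
    and sym: "\<And>i j. i < n \<Longrightarrow> j < n \<Longrightarrow> P i j = P j i"
  shows "measure_pmf.expectation (adj_pmf n P) (\<lambda>A. exp (\<Sum>i<n. \<Sum>j<n. (A i j - P i j) * G i j))
      \<le> exp ((\<Sum>i<n. \<Sum>j<n. (G i j)\<^sup>2) / 4)"
proof -
  define U where "U = {(i, j). i \<le> j \<and> j < n}"
  define F where "F e = {x \<in> {..<n} \<times> {..<n}. pair_sort x = e}" for e
  define H where "H e = (\<Sum>x\<in>F e. G (fst x) (snd x))" for e
  define Q where "Q e = P (fst e) (snd e)" for e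
  have finU: "finite U" using finite_upper_pairs by (simp add: U_def)
  have UQ: "0 \<le> Q e \<and> Q e \<le> 1" if "e \<in> U" for e using that P by (auto simp: U_def Q_def)
  have group: "(\<Sum>i<n. \<Sum>j<n. f i j) = (\<Sum>e\<in>U. \<Sum>x\<in>F e. f (fst x) (snd x))" for f :: "nat \<Rightarrow> nat \<Rightarrow> real"
  proof -
    have "(\<Sum>i<n. \<Sum>j<n. f i j) = (\<Sum>x\<in>{..<n} \<times> {..<n}. f (fst x) (snd x))"
      by (simp add: sum.cartesian_product split_def)
    also have "\<dots> = (\<Sum>e\<in>U. \<Sum>x\<in>F e. f (fst x) (snd x))"
      unfolding F_def by (rule sum.group[symmetric]) (auto simp: finU, auto simp: U_def pair_sort_def)
    finally show ?thesis .
  qed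
  have H2: "(H e)\<^sup>2 \<le> 2 * (\<Sum>x\<in>F e. (G (fst x) (snd x))\<^sup>2)" for e
  proof -
    have "(H e)\<^sup>2 \<le> (\<Sum>x\<in>F e. (G (fst x) (snd x))\<^sup>2) * (\<Sum>x\<in>F e. (1::real)\<^sup>2)"
      unfolding H_def using Cauchy_Schwarz_ineq_sum[of "\<lambda>x. G (fst x) (snd x)" "\<lambda>_. 1" "F e"] by simp
    also have "\<dots> \<le> (\<Sum>x\<in>F e. (G (fst x) (snd x))\<^sup>2) * 2"
      using card_pair_sort_fiber[of n e] by (intro mult_left_mono sum_nonneg) (auto simp: F_def)
    finally show ?thesis by simp
  qed
  have lin: "(\<Sum>i<n. \<Sum>j<n. ((if e (min i j, max i j) then 1 else 0) - P i j) * G i j)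
      = (\<Sum>d\<in>U. ((if e d then 1 else 0) - Q d) * H d)" for e
    unfolding group H_def sum_distrib_left
    by (intro sum.cong refl) (auto simp: F_def Q_def pair_sort_def min_def max_def sym)
  have "measure_pmf.expectation (adj_pmf n P) (\<lambda>A. exp (\<Sum>i<n. \<Sum>j<n. (A i j - P i j) * G i j))
      = measure_pmf.expectation (Pi_pmf U False (\<lambda>e. bernoulli_pmf (Q e)))
          (\<lambda>e. exp (\<Sum>d\<in>U. ((if e d then 1 else 0) - Q d) * H d))"
    by (simp add: adj_pmf_def lin U_def Q_def split_def)
  also have "\<dots> = measure_pmf.expectation (Pi_pmf U False (\<lambda>e. bernoulli_pmf (Q e)))
          (\<lambda>e. \<Prod>d\<in>U. exp (((if e d then 1 else 0) - Q d) * H d))"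
    by (simp add: exp_sum finU)
  also have "\<dots> = (\<Prod>d\<in>U. measure_pmf.expectation (bernoulli_pmf (Q d)) (\<lambda>b. exp (((if b then 1 else 0) - Q d) * H d)))"
    by (rule expectation_prod_Pi_pmf[OF finU]) (auto intro: integrable_measure_pmf_finite)
  also have "\<dots> \<le> (\<Prod>d\<in>U. exp ((H d)\<^sup>2 / 8))"
  proof (rule prod_mono, intro conjI)
    fix d assume d: "d \<in> U"
    show "measure_pmf.expectation (bernoulli_pmf (Q d)) (\<lambda>b. exp (((if b then 1 else 0) - Q d) * H d)) \<ge> 0"
      by simp
    have "measure_pmf.expectation (bernoulli_pmf (Q d)) (\<lambda>b. exp (((if b then 1 else 0) - Q d) * H d))
       = Q d * exp (H d * (1 - Q d)) + (1 - Q d) * exp (H d * (0 - Q d))"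
      using UQ[OF d] by (simp add: mult.commute)
    also have "\<dots> \<le> exp ((H d)\<^sup>2 / 8)" using UQ[OF d] by (intro bernoulli_mgf) auto
    finally show "measure_pmf.expectation (bernoulli_pmf (Q d)) (\<lambda>b. exp (((if b then 1 else 0) - Q d) * H d)) \<le> exp ((H d)\<^sup>2 / 8)" .
  qed
  also have "\<dots> = exp (\<Sum>d\<in>U. (H d)\<^sup>2 / 8)" by (simp add: exp_sum finU)
  also have "\<dots> \<le> exp (\<Sum>d\<in>U. 2 * (\<Sum>x\<in>F d. (G (fst x) (snd x))\<^sup>2) / 8)"
    by (simp only: exp_le_cancel_iff) (intro sum_mono divide_right_mono H2, simp)
  also have "\<dots> = exp ((\<Sum>i<n. \<Sum>j<n. (G i j)\<^sup>2) / 4)"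
    unfolding group by (simp add: sum_divide_distrib)
  finally show ?thesis .
qed

text \<open>A union bound for a random index: as \<open>\<theta> a\<close> depends on the outcome,
  its single term is enlarged to the sum over all indices that occur, each with moment at most 1.
  Finite support keeps this sum finite even for an infinite index type.\<close>

lemma expectation_le_max_weights:
  fixes Y :: "'a \<Rightarrow> real" and W :: "'t \<Rightarrow> 'a \<Rightarrow> real" and w :: "'t \<Rightarrow> real"
  assumes fin: "finite (set_pmf p)"
    and le: "\<And>a. a \<in> set_pmf p \<Longrightarrow> Y a \<le> W (\<theta> a) a - w (\<theta> a)"
    and mgf: "\<And>a. a \<in> set_pmf p \<Longrightarrow> measure_pmf.expectation p (\<lambda>b. exp (W (\<theta> a) b)) \<le> 1"
  shows "measure_pmf.expectation p (\<lambda>a. exp (Y a)) \<le> (\<Sum>t\<in>\<theta> ` set_pmf p. exp (- w t))"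
proof -
  let ?T = "\<theta> ` set_pmf p"
  have int: "integrable (measure_pmf p) f" for f :: "'a \<Rightarrow> real"
    by (rule integrable_measure_pmf_finite[OF fin])
  have "measure_pmf.expectation p (\<lambda>a. exp (Y a)) \<le> measure_pmf.expectation p (\<lambda>a. \<Sum>t\<in>?T. exp (W t a - w t))"
  proof (rule integral_mono_AE[OF int int], simp add: AE_measure_pmf_iff, intro ballI)
    fix a assume a: "a \<in> set_pmf p"
    have "exp (Y a) \<le> exp (W (\<theta> a) a - w (\<theta> a))" using le[OF a] by simp
    also have "\<dots> \<le> (\<Sum>t\<in>?T. exp (W t a - w t))"
      by (rule member_le_sum) (use a fin in auto)
    finally show "exp (Y a) \<le> (\<Sum>t\<in>?T. exp (W t a - w t))" .
  qed
  also have "\<dots> = (\<Sum>t\<in>?T. measure_pmf.expectation p (\<lambda>a. exp (W t a - w t)))"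
    by (rule Bochner_Integration.integral_sum) (rule int)
  also have "\<dots> \<le> (\<Sum>t\<in>?T. exp (- w t))"
  proof (rule sum_mono)
    fix t assume "t \<in> ?T"
    then have "measure_pmf.expectation p (\<lambda>b. exp (W t b)) \<le> 1" using mgf by auto
    then have "measure_pmf.expectation p (\<lambda>b. exp (W t b)) * exp (- w t) \<le> 1 * exp (- w t)"
      by (intro mult_right_mono) auto
    then show "measure_pmf.expectation p (\<lambda>a. exp (W t a - w t)) \<le> exp (- w t)"
      by (simp add: exp_diff exp_minus divide_inverse)
  qed
  finally show ?thesis .
qed

subsection \<open>Counting communities and supports\<close>

lemma xln_ge:
  assumes "m \<le> N"
  shows "real m \<le> xln m (real N * exp 1)"
proof (cases "m = 0")
  case False
  then have "ln (real N * exp 1 / real m) = ln (real N / real m) + 1"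
    using assms by (simp add: ln_mult ln_div)
  moreover have "ln (real N / real m) \<ge> 0" using False assms by simp
  ultimately show ?thesis using False by (simp add: xln_def)
qed (simp add: xln_def)

text \<open>Divided by \<open>fact m\<close>, the left side is a single term of the exponential
  series.\<close>

lemma power_self_le_fact_exp: "real m ^ m \<le> fact m * exp (real m)"
proof -
  have "real m ^ m / fact m \<le> exp (real m)"
    using sum_le_suminf[OF summable_exp_generic[of "real m"], of "{m}"]
    by (simp add: exp_def scaleR_conv_of_real field_simps)
  then show ?thesis by (simp add: field_simps)
qed

text \<open>For positive \<open>m\<close> the penalty exponentiates to
  \<open>(N * e / m) ^ m\<close>, the usual upper bound for the binomial coefficient:
  \<open>N choose m\<close> is at most \<open>N ^ m / fact m\<close>, and \<open>fact m\<close> is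
  at least \<open>(m / e) ^ m\<close>.\<close>

lemma binomial_exp_xln_le:
  assumes "m \<le> N"
  shows "real (N choose m) * exp (- xln m (real N * exp 1)) \<le> 1"
proof (cases "m = 0")
  case False
  then have N: "real N > 0" and m: "real m > 0" using assms by auto
  have "exp (- xln m (real N * exp 1)) = exp (- ln (real N * exp 1 / real m)) ^ m"
    using False by (simp add: xln_def exp_of_nat_mult[symmetric])
  also have "exp (- ln (real N * exp 1 / real m)) = real m / (real N * exp 1)"
    using N m by (simp add: exp_minus)
  finally have e: "exp (- xln m (real N * exp 1)) = real m ^ m / (real N ^ m * exp (real m))"
    by (simp add: power_divide power_mult_distrib exp_of_nat_mult[symmetric])
  have "real (N choose m) * fact m \<le> real N ^ m"
    using binomial_fact_pow[of N m] by (metis of_nat_fact of_nat_le_iff of_nat_mult of_nat_power)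
  then have "real (N choose m) * real m ^ m \<le> real (N choose m) * (fact m * exp (real m))"
    by (intro mult_left_mono power_self_le_fact_exp) auto
  also have "\<dots> = (real (N choose m) * fact m) * exp (real m)" by simp
  also have "\<dots> \<le> real N ^ m * exp (real m)"
    using \<open>real (N choose m) * fact m \<le> real N ^ m\<close> by (intro mult_right_mono) auto
  finally show ?thesis unfolding e using N by (simp add: divide_simps)
qed (simp add: xln_def)

lemma sum_Pow_card:
  fixes f :: "nat \<Rightarrow> real"
  assumes "finite U"
  shows "(\<Sum>S\<in>Pow U. f (card S)) = (\<Sum>m\<le>card U. real (card U choose m) * f m)"
proof -
  have "(\<Sum>S\<in>Pow U. f (card S)) = (\<Sum>m\<le>card U. \<Sum>S\<in>{S \<in> Pow U. card S = m}. f (card S))"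
    using assms by (intro sum.group[symmetric]) (auto intro: card_mono)
  also have "\<dots> = (\<Sum>m\<le>card U. real (card U choose m) * f m)"
  proof (intro sum.cong refl)
    fix m
    have "{S \<in> Pow U. card S = m} = {S. S \<subseteq> U \<and> card S = m}" by auto
    then show "(\<Sum>S\<in>{S \<in> Pow U. card S = m}. f (card S)) = real (card U choose m) * f m"
      using n_subsets[OF assms, of m] by simp
  qed
  finally show ?thesis .
qed

text \<open>Since \<open>xln\<close> is at least the cardinality, \<open>c\<close> copies of it
  absorb \<open>c * card S\<close>, one copy pays for the number of sets of that size, and one more
  leaves a geometric series. Hence the \<open>c + 2\<close>.\<close>

lemma sum_Pow_exp_xln_le:
  assumes "finite U" "0 \<le> c" "c + 2 \<le> \<kappa>"
  shows "(\<Sum>S\<in>Pow U. exp (c * real (card S) - \<kappa> * xln (card S) (real (card U) * exp 1))) \<le> 2"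
proof -
  let ?N = "card U"
  have "(\<Sum>S\<in>Pow U. exp (c * real (card S) - \<kappa> * xln (card S) (real ?N * exp 1)))
     = (\<Sum>m\<le>?N. real (?N choose m) * exp (c * real m - \<kappa> * xln m (real ?N * exp 1)))"
    by (rule sum_Pow_card[OF assms(1), where f="\<lambda>m. exp (c * real m - \<kappa> * xln m (real ?N * exp 1))"])
  also have "\<dots> \<le> (\<Sum>m\<le>?N. (1/2) ^ m)"
  proof (rule sum_mono)
    fix m assume "m \<in> {..?N}"
    then have m: "m \<le> ?N" by simp
    let ?x = "xln m (real ?N * exp 1)"
    have x: "real m \<le> ?x" using xln_ge[OF m] .
    have "c * real m - \<kappa> * ?x \<le> c * real m - (c + 2) * ?x"
      using assms x by (intro diff_left_mono mult_right_mono) auto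
    also have "\<dots> \<le> - real m - ?x"
      using x mult_left_mono[OF x, of c] assms by (simp add: algebra_simps)
    finally have "exp (c * real m - \<kappa> * ?x) \<le> exp (- real m) * exp (- ?x)"
      by (simp add: exp_add[symmetric])
    then have "real (?N choose m) * exp (c * real m - \<kappa> * ?x) \<le> real (?N choose m) * (exp (- real m) * exp (- ?x))"
      by (intro mult_left_mono) auto
    also have "\<dots> = exp (- real m) * (real (?N choose m) * exp (- ?x))" by simp
    also have "\<dots> \<le> exp (- real m) * 1"
      by (intro mult_left_mono binomial_exp_xln_le m) auto
    also have "exp (- real m) * 1 = exp (- 1) ^ m" by (simp add: exp_of_nat_mult[symmetric])
    also have "\<dots> \<le> (1/2) ^ m"
      using exp_ge_add_one_self[of 1] by (intro power_mono) (auto simp: exp_minus field_simps)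
    finally show "real (?N choose m) * exp (c * real m - \<kappa> * ?x) \<le> (1/2) ^ m" .
  qed
  also have "\<dots> \<le> 2" using geometric_sum_less[of "1/2::real" "{..?N}"] by simp
  finally show ?thesis .
qed

section \<open>Supports coded as sets of node-community pairs\<close>

definition blk :: "nat \<Rightarrow> (nat \<Rightarrow> nat) \<Rightarrow> (nat \<times> nat) set \<Rightarrow> nat \<Rightarrow> nat \<Rightarrow> nat set" where
  "blk n z S k l = {i \<in> community n z k. (i, l) \<in> S}"

text \<open>The two properties that minimality forces under the separate penalty, see
  \<open>solution_reduced\<close>. They make the unpaid supports of single-node communities
  recoverable from the others.\<close>

definition reduced :: "nat \<Rightarrow> (nat \<Rightarrow> nat) \<Rightarrow> nat \<Rightarrow> (nat \<times> nat) set \<Rightarrow> bool" where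
  "reduced n z K S \<longleftrightarrow> (\<forall>k<K. \<forall>l<K. blk n z S k l \<noteq> {} \<longrightarrow>
     blk n z S l k \<noteq> {} \<and> \<not> (card (community n z k) = 1 \<and> card (community n z l) = 1))"

lemma finite_community [simp]: "finite (community n z k)"
  by (simp add: community_def)

lemma blk_subset: "blk n z S k l \<subseteq> community n z k"
  by (auto simp: blk_def)

lemma finite_blk [simp]: "finite (blk n z S k l)"
  using blk_subset by (rule finite_subset) simp

lemma card_blk_le: "card (blk n z S k l) \<le> card (community n z k)"
  by (intro card_mono blk_subset finite_community)

lemma sum_blk:
  fixes h :: "nat \<times> nat \<Rightarrow> 'b :: comm_monoid_add"
  assumes z: "\<And>i. i < n \<Longrightarrow> z i < K" and S: "S \<subseteq> {..<n} \<times> {..<K}"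
  shows "(\<Sum>k<K. \<Sum>l<K. \<Sum>i\<in>blk n z S k l. h (i, l)) = (\<Sum>p\<in>S. h p)"
proof -
  have "(\<Sum>k<K. \<Sum>l<K. \<Sum>i\<in>blk n z S k l. h (i, l))
      = (\<Sum>q\<in>{..<K} \<times> {..<K}. \<Sum>i\<in>blk n z S (fst q) (snd q). h (i, snd q))"
    by (simp add: sum.cartesian_product split_def)
  also have "\<dots> = (\<Sum>q\<in>{..<K} \<times> {..<K}. \<Sum>p\<in>{p \<in> S. (z (fst p), snd p) = q}. h p)"
  proof (intro sum.cong refl)
    fix q assume "q \<in> {..<K} \<times> {..<K}"
    show "(\<Sum>i\<in>blk n z S (fst q) (snd q). h (i, snd q)) = (\<Sum>p\<in>{p \<in> S. (z (fst p), snd p) = q}. h p)"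
      using S by (intro sum.reindex_bij_witness[of _ fst "\<lambda>i. (i, snd q)"])
        (auto simp: blk_def community_def)
  qed
  also have "\<dots> = (\<Sum>p\<in>S. h p)"
    using S z by (intro sum.group) (auto intro: finite_subset)
  finally show ?thesis .
qed

lemma card_sum_blk:
  assumes "\<And>i. i < n \<Longrightarrow> z i < K" and "S \<subseteq> {..<n} \<times> {..<K}"
  shows "(\<Sum>k<K. \<Sum>l<K. real (card (blk n z S k l))) = real (card S)"
  using sum_blk[OF assms, where h = "\<lambda>_. 1::real"] by simp

text \<open>A row block of a single-node community is empty or the whole community, so only
  emptiness is in question. Reducedness makes the block empty if the other community is a singleton
  too, and otherwise ties its emptiness to the transposed block, which lies in a large row.\<close>

lemma reduced_determined_by_large_rows:
  assumes z: "clustering n K z" and S: "S \<subseteq> {..<n} \<times> {..<K}" "S' \<subseteq> {..<n} \<times> {..<K}"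
    and red: "reduced n z K S" "reduced n z K S'"
    and eq: "\<And>k l. k < K \<Longrightarrow> l < K \<Longrightarrow> 2 \<le> card (community n z k) \<Longrightarrow> blk n z S k l = blk n z S' k l"
  shows "S \<subseteq> S'"
proof
  fix p assume p: "p \<in> S"
  obtain i l where il: "p = (i, l)" by (cases p)
  define k where "k = z i"
  have b: "i < n" "l < K" "k < K" using p il S z by (auto simp: clustering_def k_def)
  have i: "i \<in> blk n z S k l" using p il b by (auto simp: blk_def community_def k_def)
  have "i \<in> blk n z S' k l"
  proof (cases "2 \<le> card (community n z k)")
    case True
    then show ?thesis using i eq b by blast
  next
    case False
    have "i \<in> community n z k" using b by (simp add: community_def k_def)
    then have "card (community n z k) > 0" by (auto simp: card_gt_0_iff)
    then have one: "card (community n z k) = 1" using False by simp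
    then have ki: "community n z k = {i}" using \<open>i \<in> community n z k\<close> by (auto simp: card_1_singleton_iff)
    have "blk n z S l k \<noteq> {}" "card (community n z l) \<noteq> 1"
      using red(1) i b one unfolding reduced_def by blast+
    moreover have "community n z l \<noteq> {}" using z b by (auto simp: clustering_def)
    ultimately have "2 \<le> card (community n z l)"
      by (metis One_nat_def Suc_1 card_0_eq finite_community le_SucE le_zero_eq not_less_eq_eq)
    then have "blk n z S' l k \<noteq> {}" using eq[of l k] b \<open>blk n z S l k \<noteq> {}\<close> by simp
    then have "blk n z S' k l \<noteq> {}" using red(2) b unfolding reduced_def by blast
    then show ?thesis using blk_subset[of n z S' k l] ki by auto
  qed
  then show "p \<in> S'" using il by (auto simp: blk_def)
qed

text \<open>The union runs over the blocks whose row community has at least two nodes, since these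
  determine a reduced \<open>S\<close>. The factor \<open>K\<close> before the logarithms supplies
  one divisor \<open>n_k\<close>, at least 2, per block, which cancels the 2 from
  \<open>sum_Pow_exp_xln_le\<close>.\<close>

lemma sum_sets_sep:
  assumes z: "clustering n K z" and c: "0 \<le> c" "c + 2 \<le> \<kappa>"
    and T: "T \<subseteq> {S. S \<subseteq> {..<n} \<times> {..<K} \<and> reduced n z K S}"
  shows "(\<Sum>S\<in>T. exp (c * real (card S)
      - \<kappa> * (\<Sum>k<K. \<Sum>l<K. xln (card (blk n z S k l)) (real (card (community n z k)) * exp 1))
      - real K * (\<Sum>k<K. ln (real (card (community n z k)))))) \<le> 1"
proof -
  let ?n = "\<lambda>k. card (community n z k)"
  define B where "B = {k. k < K \<and> 2 \<le> ?n k} \<times> {..<K}"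
  define g where "g = (\<lambda>q::nat\<times>nat. \<lambda>I::nat set. exp (c * real (card I) - \<kappa> * xln (card I) (real (?n (fst q)) * exp 1)
      - ln (real (?n (fst q)))))"
  define \<phi> where "\<phi> S = restrict (\<lambda>q. blk n z S (fst q) (snd q)) B" for S
  have finB: "finite B" by (simp add: B_def)
  have BK: "B \<subseteq> {..<K} \<times> {..<K}" by (auto simp: B_def)
  have n1: "1 \<le> ?n k" if "k < K" for k
    using z that by (auto simp: clustering_def Suc_le_eq card_gt_0_iff)
  have finT: "finite T" using T by (rule finite_subset) (rule finite_subset[of _ "Pow ({..<n} \<times> {..<K})"], auto)
  have inj: "inj_on \<phi> T"
  proof (rule inj_onI)
    fix S S' assume S: "S \<in> T" "S' \<in> T" and eq: "\<phi> S = \<phi> S'"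
    have e: "blk n z S k l = blk n z S' k l" if "k < K" "l < K" "2 \<le> ?n k" for k l
      using fun_cong[OF eq, of "(k, l)"] that by (simp add: \<phi>_def B_def)
    show "S = S'"
      using reduced_determined_by_large_rows[OF z, of S S'] reduced_determined_by_large_rows[OF z, of S' S] S T e
      by (metis (mono_tags, lifting) mem_Collect_eq subset_antisym subset_eq)
  qed
  have weight: "exp (c * real (card S)
      - \<kappa> * (\<Sum>k<K. \<Sum>l<K. xln (card (blk n z S k l)) (real (?n k) * exp 1))
      - real K * (\<Sum>k<K. ln (real (?n k)))) \<le> (\<Prod>q\<in>B. g q (\<phi> S q))" if "S \<in> T" for S
  proof -
    let ?t = "\<lambda>q. c * real (card (blk n z S (fst q) (snd q)))
      - \<kappa> * xln (card (blk n z S (fst q) (snd q))) (real (?n (fst q)) * exp 1) - ln (real (?n (fst q)))"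
    have S: "S \<subseteq> {..<n} \<times> {..<K}" using that T by auto
    have zK: "\<And>i. i < n \<Longrightarrow> z i < K" using z by (simp add: clustering_def)
    have "c * real (card S)
      - \<kappa> * (\<Sum>k<K. \<Sum>l<K. xln (card (blk n z S k l)) (real (?n k) * exp 1))
      - real K * (\<Sum>k<K. ln (real (?n k))) = (\<Sum>k<K. \<Sum>l<K. ?t (k, l))"
      using card_sum_blk[OF zK S] by (simp add: sum_subtractf sum_distrib_left[symmetric])
    also have "\<dots> = (\<Sum>q\<in>{..<K} \<times> {..<K}. ?t q)" by (simp add: sum.cartesian_product split_def)
    also have "\<dots> \<le> (\<Sum>q\<in>B. ?t q)"
    proof -
      \<comment> \<open>Blocks outside \<open>B\<close> may be dropped: their exponent is
        nonpositive because \<open>c\<close> is below \<open>\<kappa>\<close> and \<open>xln\<close>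
        dominates the cardinality.\<close>
      have "?t q \<le> 0" if "q \<in> {..<K} \<times> {..<K} - B" for q
      proof -
        have "c * real (card (blk n z S (fst q) (snd q))) \<le> \<kappa> * real (card (blk n z S (fst q) (snd q)))"
          using c by (intro mult_right_mono) auto
        also have "\<dots> \<le> \<kappa> * xln (card (blk n z S (fst q) (snd q))) (real (?n (fst q)) * exp 1)"
          using c by (intro mult_left_mono xln_ge card_blk_le) auto
        moreover have "ln (real (?n (fst q))) \<ge> 0" using n1[of "fst q"] that by auto
        ultimately show ?thesis by linarith
      qed
      then have "(\<Sum>q\<in>{..<K} \<times> {..<K} - B. ?t q) \<le> 0" by (intro sum_nonpos)
      then show ?thesis using sum.subset_diff[OF BK, of ?t] by simp
    qed
    finally have "exp (c * real (card S)
      - \<kappa> * (\<Sum>k<K. \<Sum>l<K. xln (card (blk n z S k l)) (real (?n k) * exp 1))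
      - real K * (\<Sum>k<K. ln (real (?n k)))) \<le> exp (\<Sum>q\<in>B. ?t q)" by simp
    also have "\<dots> = (\<Prod>q\<in>B. g q (\<phi> S q))" by (simp add: exp_sum finB g_def \<phi>_def)
    finally show ?thesis .
  qed
  have "(\<Sum>S\<in>T. exp (c * real (card S)
      - \<kappa> * (\<Sum>k<K. \<Sum>l<K. xln (card (blk n z S k l)) (real (?n k) * exp 1))
      - real K * (\<Sum>k<K. ln (real (?n k))))) \<le> (\<Sum>S\<in>T. \<Prod>q\<in>B. g q (\<phi> S q))"
    by (intro sum_mono weight)
  also have "\<dots> = (\<Sum>f\<in>\<phi> ` T. \<Prod>q\<in>B. g q (f q))" by (simp add: sum.reindex[OF inj])
  \<comment> \<open>Enlarging the injective image to all independent choices of block supports lets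
    the sum of products factor into a product of sums.\<close>
  also have "\<dots> \<le> (\<Sum>f\<in>PiE B (\<lambda>q. Pow (community n z (fst q))). \<Prod>q\<in>B. g q (f q))"
  proof (rule sum_mono2)
    show "finite (PiE B (\<lambda>q. Pow (community n z (fst q))))" by (intro finite_PiE finB) auto
    show "\<phi> ` T \<subseteq> PiE B (\<lambda>q. Pow (community n z (fst q)))"
      using blk_subset by (force simp: \<phi>_def)
  qed (auto simp: g_def intro!: prod_nonneg)
  also have "\<dots> = (\<Prod>q\<in>B. \<Sum>I\<in>Pow (community n z (fst q)). g q I)"
    by (rule prod_sum_PiE[symmetric]) (auto simp: finB)
  also have "\<dots> \<le> (\<Prod>q\<in>B. 1)"
  proof (rule prod_mono, intro conjI)
    fix q assume q: "q \<in> B"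
    show "(\<Sum>I\<in>Pow (community n z (fst q)). g q I) \<ge> 0" by (intro sum_nonneg) (simp add: g_def)
    have n2: "2 \<le> real (?n (fst q))" using q by (auto simp: B_def)
    have "(\<Sum>I\<in>Pow (community n z (fst q)). g q I)
       = (\<Sum>I\<in>Pow (community n z (fst q)). exp (c * real (card I) - \<kappa> * xln (card I) (real (?n (fst q)) * exp 1)))
          / real (?n (fst q))"
      using n2 by (simp add: g_def exp_diff sum_divide_distrib)
    also have "\<dots> \<le> 2 / real (?n (fst q))"
      by (intro divide_right_mono sum_Pow_exp_xln_le c) auto
    also have "\<dots> \<le> 1" using n2 by simp
    finally show "(\<Sum>I\<in>Pow (community n z (fst q)). g q I) \<le> 1" .
  qed
  finally show ?thesis by simp
qed

text \<open>The common part of both penalties pays for the labels and for \<open>K\<close>: it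
  contributes the divisor \<open>n * K ^ n\<close>, against \<open>K ^ n\<close> labellings and
  \<open>n\<close> values of \<open>K\<close>. The rest pays for the supports, block by block under
  the separate penalty and by a single binomial count over \<open>n * K\<close> positions
  otherwise.\<close>

lemma sum_models_le:
  assumes c: "0 \<le> c" "c + 2 \<le> \<kappa>" and n: "n > 0"
    and T: "\<And>K z S. (K, z, S) \<in> T \<Longrightarrow> K \<in> {1..n} \<and> z \<in> PiE {..<n} (\<lambda>_. {..<K}) \<and> clustering n K z
        \<and> S \<subseteq> {..<n} \<times> {..<K} \<and> (is_sp \<longrightarrow> reduced n z K S)"
  shows "(\<Sum>(K, z, S)\<in>T. exp (c * real (card S) - pen is_sp \<kappa> 1 n z K (blk n z S))) \<le> 2"
proof -
  define F where "F K z = {S. (K, z, S) \<in> T}" for K z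
  define Z where "Z K = PiE {..<n} (\<lambda>_::nat. {..<K::nat})" for K
  have finZ: "finite (Z K)" for K unfolding Z_def by (intro finite_PiE) auto
  have FK: "F K z \<subseteq> Pow ({..<n} \<times> {..<K})" for K z using T by (auto simp: F_def)
  have finF: "finite (F K z)" for K z using FK by (rule finite_subset) simp
  have Teq: "T = Sigma {1..n} (\<lambda>K. Sigma (Z K) (F K))"
    using T by (fastforce simp: F_def Z_def)
  have inner: "(\<Sum>S\<in>F K z. exp (c * real (card S) - pen is_sp \<kappa> 1 n z K (blk n z S))) \<le> 2 / (real n * real K ^ n)"
    if K: "K \<in> {1..n}" and z: "z \<in> Z K" for K z
  proof (cases "F K z = {}")
    case False
    then have zc: "clustering n K z" and red: "is_sp \<longrightarrow> F K z \<subseteq> {S. S \<subseteq> {..<n} \<times> {..<K} \<and> reduced n z K S}"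
      using T FK by (auto simp: F_def)
    \<comment> \<open>Minus the penalty without its common part.\<close>
    define r where "r S = (if is_sp then
        - \<kappa> * (\<Sum>k<K. \<Sum>l<K. xln (card (blk n z S k l)) (real (card (community n z k)) * exp 1))
        - real K * (\<Sum>k<K. ln (real (card (community n z k))))
      else - \<kappa> * xln (card_family K (blk n z S)) (real n * real K * exp 1) - 2 * ln (real n))" for S
    have e: "exp (c * real (card S) - pen is_sp \<kappa> 1 n z K (blk n z S))
       = exp (c * real (card S) + r S) * (1 / (real n * real K ^ n))" for S
    proof -
      have "exp (real n * ln (real K)) = real K ^ n"
        using K by (simp add: exp_of_nat_mult)
      then have "exp (- (real n * ln (real K) + ln (real n))) = 1 / (real n * real K ^ n)"
        using n by (simp add: exp_minus exp_add inverse_eq_divide del: minus_add_distrib)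
      moreover have "c * real (card S) - pen is_sp \<kappa> 1 n z K (blk n z S)
        = (c * real (card S) + r S) + (- (real n * ln (real K) + ln (real n)))"
        by (simp add: pen_def pen_s_def pen_ns_def r_def)
      ultimately show ?thesis by (simp only: exp_add)
    qed
    have "(\<Sum>S\<in>F K z. exp (c * real (card S) + r S)) \<le> 2"
    proof (cases is_sp)
      case True
      have "(\<Sum>S\<in>F K z. exp (c * real (card S) + r S)) \<le> 1"
        using sum_sets_sep[OF zc c] red True by (simp add: r_def algebra_simps)
      then show ?thesis by simp
    next
      case False
      have zK: "\<And>i. i < n \<Longrightarrow> z i < K" using zc by (simp add: clustering_def)
      have "(\<Sum>S\<in>F K z. exp (c * real (card S) + r S))
         \<le> (\<Sum>S\<in>F K z. exp (c * real (card S) - \<kappa> * xln (card S) (real (card ({..<n} \<times> {..<K})) * exp 1)))"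
      proof (rule sum_mono)
        fix S assume "S \<in> F K z"
        then have "S \<subseteq> {..<n} \<times> {..<K}" using FK by auto
        from card_sum_blk[OF zK this] have "card_family K (blk n z S) = card S"
          unfolding card_family_def by (simp flip: of_nat_sum)
        then show "exp (c * real (card S) + r S)
          \<le> exp (c * real (card S) - \<kappa> * xln (card S) (real (card ({..<n} \<times> {..<K})) * exp 1))"
          using False n by (simp add: r_def)
      qed
      also have "\<dots> \<le> (\<Sum>S\<in>Pow ({..<n} \<times> {..<K}). exp (c * real (card S) - \<kappa> * xln (card S) (real (card ({..<n} \<times> {..<K})) * exp 1)))"
        using FK by (intro sum_mono2) auto
      also have "\<dots> \<le> 2" by (rule sum_Pow_exp_xln_le) (use c in auto)
      finally show ?thesis .
    qed
    then have "(\<Sum>S\<in>F K z. exp (c * real (card S) + r S)) * (1 / (real n * real K ^ n)) \<le> 2 * (1 / (real n * real K ^ n))"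
      by (intro mult_right_mono) auto
    then show ?thesis unfolding e by (simp only: sum_distrib_right)
  qed simp
  have "(\<Sum>(K, z, S)\<in>T. exp (c * real (card S) - pen is_sp \<kappa> 1 n z K (blk n z S)))
     = (\<Sum>K=1..n. \<Sum>z\<in>Z K. \<Sum>S\<in>F K z. exp (c * real (card S) - pen is_sp \<kappa> 1 n z K (blk n z S)))"
    unfolding Teq by (simp add: sum.Sigma finZ finF)
  also have "\<dots> \<le> (\<Sum>K=1..n. \<Sum>z\<in>Z K. 2 / (real n * real K ^ n))"
    by (intro sum_mono inner)
  also have "\<dots> = (\<Sum>K=1..n. 2 / real n)"
    by (intro sum.cong refl) (simp add: Z_def card_PiE)
  also have "\<dots> = 2" using n by simp
  finally show ?thesis .
qed

subsection \<open>Lattice matrices\<close>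

text \<open>A pair \<open>(i, l) \<in> S\<close> stands for \<open>i \<in> J\<^bsub>z i, l\<^esub>\<close>. Thus \<open>U i l k\<close> and \<open>V j k l\<close> are the entries of the
  rank-one factors of block \<open>(k, l)\<close>.\<close>

definition low_rank :: "nat \<Rightarrow> (nat \<Rightarrow> nat) \<Rightarrow> (nat \<times> nat) set \<Rightarrow> (nat \<Rightarrow> nat \<Rightarrow> real) \<Rightarrow> bool" where
  "low_rank n z S M \<longleftrightarrow> (\<exists>U V. \<forall>i<n. \<forall>j<n. M i j =
     (if (i, z j) \<in> S \<and> (j, z i) \<in> S then U i (z j) (z i) * V j (z i) (z j) else 0))"

text \<open>The first two components of \<open>q\<close> are used for the row vectors, the last two for the column
  vectors, so that a matrix of rank two in every block is coded by a single function on \<open>S\<close>.\<close>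

definition lattice :: "nat \<Rightarrow> (nat \<Rightarrow> nat) \<Rightarrow> (nat \<times> nat) set \<Rightarrow> (nat \<times> nat \<Rightarrow> int \<times> int \<times> int \<times> int)
    \<Rightarrow> nat \<Rightarrow> nat \<Rightarrow> real" where
  "lattice n z S q i j = (if (i, z j) \<in> S \<and> (j, z i) \<in> S
     then (case (q (i, z j), q (j, z i)) of ((x, x', _, _), (_, _, y, y')) \<Rightarrow>
       (of_int x * of_int y + of_int x' * of_int y') / sqrt (card (blk n z S (z j) (z i)))) else 0)"

definition size4 :: "int \<times> int \<times> int \<times> int \<Rightarrow> int" where
  "size4 q = (case q of (x, x', y, y') \<Rightarrow> \<bar>x\<bar> + \<bar>x'\<bar> + \<bar>y\<bar> + \<bar>y'\<bar>)"

lemma sum_community: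
  fixes f :: "nat \<Rightarrow> 'b :: comm_monoid_add"
  assumes z: "\<And>i. i < n \<Longrightarrow> z i < K"
  shows "(\<Sum>i<n. f i) = (\<Sum>k<K. \<Sum>i\<in>community n z k. f i)"
proof -
  have "(\<Sum>k<K. \<Sum>i\<in>{i \<in> {..<n}. z i = k}. f i) = (\<Sum>i<n. f i)"
    using z by (intro sum.group) auto
  then show ?thesis by (simp add: community_def)
qed

lemma sum_blocks:
  fixes f :: "nat \<Rightarrow> nat \<Rightarrow> 'b :: comm_monoid_add"
  assumes z: "\<And>i. i < n \<Longrightarrow> z i < K"
  shows "(\<Sum>i<n. \<Sum>j<n. f i j) = (\<Sum>k<K. \<Sum>l<K. \<Sum>i\<in>community n z k. \<Sum>j\<in>community n z l. f i j)"
proof -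
  have "(\<Sum>i<n. \<Sum>j<n. f i j) = (\<Sum>k<K. \<Sum>i\<in>community n z k. \<Sum>l<K. \<Sum>j\<in>community n z l. f i j)"
    by (simp add: sum_community[where n = n and z = z and K = K, OF z])
  then show ?thesis by (simp add: sum.swap[of _ "{..<K}" "community n z _"])
qed

lemma sum_blk_blk:
  fixes f :: "nat \<Rightarrow> nat \<Rightarrow> 'b :: comm_monoid_add"
  assumes z: "\<And>i. i < n \<Longrightarrow> z i < K"
    and f: "\<And>i j. i < n \<Longrightarrow> j < n \<Longrightarrow> \<not> ((i, z j) \<in> S \<and> (j, z i) \<in> S) \<Longrightarrow> f i j = 0"
  shows "(\<Sum>i<n. \<Sum>j<n. f i j) = (\<Sum>k<K. \<Sum>l<K. \<Sum>i\<in>blk n z S k l. \<Sum>j\<in>blk n z S l k. f i j)"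
proof -
  have "(\<Sum>i\<in>community n z k. \<Sum>j\<in>community n z l. f i j)
      = (\<Sum>i\<in>blk n z S k l. \<Sum>j\<in>blk n z S l k. f i j)" for k l
  proof -
    have "(\<Sum>i\<in>community n z k. \<Sum>j\<in>community n z l. f i j) = (\<Sum>i\<in>blk n z S k l. \<Sum>j\<in>community n z l. f i j)"
      by (rule sum.mono_neutral_right) (auto simp: blk_def community_def f intro!: sum.neutral)
    also have "\<dots> = (\<Sum>i\<in>blk n z S k l. \<Sum>j\<in>blk n z S l k. f i j)"
      by (intro sum.cong refl sum.mono_neutral_right) (auto simp: blk_def community_def f)
    finally show ?thesis .
  qed
  moreover have "(\<Sum>i<n. \<Sum>j<n. f i j) = (\<Sum>k<K. \<Sum>l<K. \<Sum>i\<in>community n z k. \<Sum>j\<in>community n z l. f i j)"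
    by (rule sum_blocks) (rule z)
  ultimately show ?thesis by simp
qed

lemma abs_le_square_int: "\<bar>x\<bar> \<le> x\<^sup>2" for x :: int
proof (cases "x = 0")
  case False
  then have "\<bar>x\<bar> * 1 \<le> \<bar>x\<bar> * \<bar>x\<bar>" by (intro mult_left_mono) auto
  then show ?thesis by (simp add: power2_eq_square)
qed simp

lemma sum_mono_2:
  fixes f g :: "nat \<Rightarrow> nat \<Rightarrow> real"
  assumes "\<And>k l. f k l \<le> g k l"
  shows "(\<Sum>k<K. \<Sum>l<K. f k l) \<le> (\<Sum>k<K. \<Sum>l<K. g k l)"
  using assms by (intro sum_mono)

lemma abs_add_abs_le_squares:
  "real_of_int (\<bar>x\<bar> + \<bar>y\<bar>) \<le> (real_of_int x)\<^sup>2 + (real_of_int y)\<^sup>2"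
  using abs_le_square_int[of x] abs_le_square_int[of y]
  by (metis add_mono of_int_add of_int_le_iff of_int_power)

text \<open>Each support block is handled by \<open>rank_two_round\<close> and the vectors are glued
  together. A pair \<open>(i, l)\<close> is a row index of block \<open>(z i, l)\<close> and a
  column index of block \<open>(l, z i)\<close>, so it receives two integers from each. The 12 in
  the size bound is 4 for the rows plus 8 for the columns.\<close>

lemma lattice_round:
  assumes z: "\<And>i. i < n \<Longrightarrow> z i < K" and S: "S \<subseteq> {..<n} \<times> {..<K}"
    and M: "low_rank n z S M" and M': "low_rank n z S M'"
  obtains q where "(\<Sum>i<n. \<Sum>j<n. \<Xi> i j * (M i j - M' i j)) \<le> (\<Sum>i<n. \<Sum>j<n. \<Xi> i j * lattice n z S q i j)"
    and "real_of_int (\<Sum>p\<in>S. size4 (q p)) \<le> 2 * frob_sq n M M' + 12 * real (card S)"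
    and "(\<Sum>i<n. \<Sum>j<n. (lattice n z S q i j)\<^sup>2) \<le> 16 * frob_sq n M M' + 32 * real (card S)"
    and "q \<in> extensional S"
proof -
  obtain U V where M: "\<And>i j. i < n \<Longrightarrow> j < n \<Longrightarrow> M i j =
     (if (i, z j) \<in> S \<and> (j, z i) \<in> S then U i (z j) (z i) * V j (z i) (z j) else 0)"
    using M unfolding low_rank_def by blast
  obtain U' V' where M': "\<And>i j. i < n \<Longrightarrow> j < n \<Longrightarrow> M' i j =
     (if (i, z j) \<in> S \<and> (j, z i) \<in> S then U' i (z j) (z i) * V' j (z i) (z j) else 0)"
    using M' unfolding low_rank_def by blast
  define B where "B = blk n z S"
  define D where "D i j = M i j - M' i j" for i j
  have Bz: "i < n \<and> z i = k \<and> (i, l) \<in> S" if "i \<in> B k l" for i k l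
    using that by (auto simp: B_def blk_def community_def)
  define R where "R k l = (\<Sum>i\<in>B k l. \<Sum>j\<in>B l k. (D i j)\<^sup>2)" for k l
  have D: "D i j = U i l k * V j k l - U' i l k * V' j k l" if "i \<in> B k l" "j \<in> B l k" for i j k l
    using Bz[OF that(1)] Bz[OF that(2)] by (simp add: D_def M M')
  define P where "P k l = (\<lambda>(x, x', y, y').
     (\<Sum>i\<in>B k l. \<Sum>j\<in>B l k. \<Xi> i j * D i j)
       \<le> (\<Sum>i\<in>B k l. \<Sum>j\<in>B l k. \<Xi> i j * ((of_int (x i) * of_int (y j) + of_int (x' i) * of_int (y' j)) / sqrt (card (B l k))))
     \<and> (\<Sum>i\<in>B k l. (real_of_int (x i))\<^sup>2 + (of_int (x' i))\<^sup>2) \<le> 2 * R k l + 4 * real (card (B k l))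
     \<and> (\<Sum>j\<in>B l k. (real_of_int (y j))\<^sup>2 + (of_int (y' j))\<^sup>2) \<le> 8 * real (card (B l k))
     \<and> (\<Sum>i\<in>B k l. \<Sum>j\<in>B l k. ((of_int (x i) * of_int (y j) + of_int (x' i) * of_int (y' j)) / sqrt (card (B l k)))\<^sup>2)
        \<le> 16 * R k l + 32 * real (card (B k l)))" for k l
  have "\<exists>w. P k l w" for k l
  proof -
    have "(\<Sum>i\<in>B k l. \<Sum>j\<in>B l k. \<Xi> i j * D i j) = (\<Sum>i\<in>B k l. \<Sum>j\<in>B l k. \<Xi> i j * (U i l k * V j k l - U' i l k * V' j k l))"
      "R k l = (\<Sum>i\<in>B k l. \<Sum>j\<in>B l k. (U i l k * V j k l - U' i l k * V' j k l)\<^sup>2)"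
      by (simp_all add: R_def D cong: sum.cong)
    note e = this
    show ?thesis
    proof (rule rank_two_round[of "B k l" "B l k" \<Xi> "\<lambda>i. U i l k" "\<lambda>j. V j k l" "\<lambda>i. U' i l k" "\<lambda>j. V' j k l"], goal_cases)
      case (3 x x' y y')
      then have "P k l (x, x', y, y')" unfolding P_def e by simp
      then show ?case ..
    qed (auto simp: B_def)
  qed
  then obtain w where w: "\<And>k l. P k l (w k l)" by metis
  define X where "X k l = fst (w k l)" for k l
  define X' where "X' k l = fst (snd (w k l))" for k l
  define Y where "Y k l = fst (snd (snd (w k l)))" for k l
  define Y' where "Y' k l = snd (snd (snd (w k l)))" for k l
  have "P k l (X k l, X' k l, Y k l, Y' k l)" for k l
    using w[of k l] by (simp add: X_def X'_def Y_def Y'_def)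
  note P = this[unfolded P_def prod.case]
  define q where "q = restrict (\<lambda>(i, l). (X (z i) l i, X' (z i) l i, Y l (z i) i, Y' l (z i) i)) S"
  have lat: "lattice n z S q i j
     = (of_int (X k l i) * of_int (Y k l j) + of_int (X' k l i) * of_int (Y' k l j)) / sqrt (card (B l k))"
    if "i \<in> B k l" "j \<in> B l k" for i j k l
    using Bz[OF that(1)] Bz[OF that(2)] by (simp add: lattice_def q_def B_def)
  note blocks = sum_blk_blk[where n = n and z = z and K = K and S = S, OF z, folded B_def]
  have "frob_sq n M M' = (\<Sum>k<K. \<Sum>l<K. R k l)"
    unfolding R_def frob_sq_def D_def by (rule blocks) (auto simp: M M')
  note R = this[symmetric]
  have cS: "(\<Sum>k<K. \<Sum>l<K. real (card (B k l))) = real (card S)"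
    using card_sum_blk[OF z S] by (simp add: B_def)
  have "(\<Sum>i<n. \<Sum>j<n. \<Xi> i j * (M i j - M' i j)) = (\<Sum>k<K. \<Sum>l<K. \<Sum>i\<in>B k l. \<Sum>j\<in>B l k. \<Xi> i j * D i j)"
    unfolding D_def by (rule blocks) (auto simp: M M')
  also have "\<dots> \<le> (\<Sum>k<K. \<Sum>l<K. \<Sum>i\<in>B k l. \<Sum>j\<in>B l k. \<Xi> i j * lattice n z S q i j)"
    using P by (intro sum_mono_2) (simp add: lat cong: sum.cong)
  also have "\<dots> = (\<Sum>i<n. \<Sum>j<n. \<Xi> i j * lattice n z S q i j)"
    by (rule blocks[symmetric]) (auto simp: lattice_def)
  finally have 1: "(\<Sum>i<n. \<Sum>j<n. \<Xi> i j * (M i j - M' i j)) \<le> \<dots>" .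
  have "(\<Sum>i<n. \<Sum>j<n. (lattice n z S q i j)\<^sup>2) = (\<Sum>k<K. \<Sum>l<K. \<Sum>i\<in>B k l. \<Sum>j\<in>B l k. (lattice n z S q i j)\<^sup>2)"
    by (rule blocks) (auto simp: lattice_def)
  also have "\<dots> \<le> (\<Sum>k<K. \<Sum>l<K. 16 * R k l + 32 * real (card (B k l)))"
    using P by (intro sum_mono_2) (simp add: lat cong: sum.cong)
  also have "\<dots> = 16 * frob_sq n M M' + 32 * real (card S)"
    by (simp add: sum.distrib sum_distrib_left[symmetric] R cS)
  finally have 2: "(\<Sum>i<n. \<Sum>j<n. (lattice n z S q i j)\<^sup>2) \<le> \<dots>" .
  define s where "s p = (\<bar>X (z (fst p)) (snd p) (fst p)\<bar> + \<bar>X' (z (fst p)) (snd p) (fst p)\<bar>)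
     + (\<bar>Y (snd p) (z (fst p)) (fst p)\<bar> + \<bar>Y' (snd p) (z (fst p)) (fst p)\<bar>)" for p
  have "real_of_int (\<Sum>p\<in>S. size4 (q p)) = real_of_int (\<Sum>p\<in>S. s p)"
    by (intro arg_cong[where f = real_of_int] sum.cong refl) (auto simp: q_def size4_def s_def)
  also have "\<dots> = (\<Sum>k<K. \<Sum>l<K. \<Sum>i\<in>B k l. real_of_int (s (i, l)))"
    using sum_blk[OF z S, where h = "\<lambda>p. real_of_int (s p)"] by (simp add: B_def)
  also have "\<dots> = (\<Sum>k<K. \<Sum>l<K. \<Sum>i\<in>B k l. real_of_int (\<bar>X k l i\<bar> + \<bar>X' k l i\<bar>) + real_of_int (\<bar>Y l k i\<bar> + \<bar>Y' l k i\<bar>))"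
    by (intro sum.cong refl) (auto simp: s_def dest: Bz)
  also have "\<dots> = (\<Sum>k<K. \<Sum>l<K. \<Sum>i\<in>B k l. real_of_int (\<bar>X k l i\<bar> + \<bar>X' k l i\<bar>))
      + (\<Sum>k<K. \<Sum>l<K. \<Sum>i\<in>B k l. real_of_int (\<bar>Y l k i\<bar> + \<bar>Y' l k i\<bar>))"
    by (simp only: sum.distrib)
  \<comment> \<open>Exchanging \<open>k\<close> and \<open>l\<close> lets the column vectors range
    over the columns of block \<open>(k, l)\<close>, the form in which their bound is
    available.\<close>
  also have "(\<Sum>k<K. \<Sum>l<K. \<Sum>i\<in>B k l. real_of_int (\<bar>Y l k i\<bar> + \<bar>Y' l k i\<bar>))
      = (\<Sum>k<K. \<Sum>l<K. \<Sum>j\<in>B l k. real_of_int (\<bar>Y k l j\<bar> + \<bar>Y' k l j\<bar>))"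
    by (rule sum.swap)
  also have "(\<Sum>k<K. \<Sum>l<K. \<Sum>i\<in>B k l. real_of_int (\<bar>X k l i\<bar> + \<bar>X' k l i\<bar>))
      \<le> (\<Sum>k<K. \<Sum>l<K. \<Sum>i\<in>B k l. (real_of_int (X k l i))\<^sup>2 + (of_int (X' k l i))\<^sup>2)"
    by (intro sum_mono abs_add_abs_le_squares)
  also have "\<dots> \<le> (\<Sum>k<K. \<Sum>l<K. 2 * R k l + 4 * real (card (B k l)))"
    using P by (intro sum_mono_2) simp
  also have "(\<Sum>k<K. \<Sum>l<K. \<Sum>j\<in>B l k. real_of_int (\<bar>Y k l j\<bar> + \<bar>Y' k l j\<bar>))
      \<le> (\<Sum>k<K. \<Sum>l<K. \<Sum>j\<in>B l k. (real_of_int (Y k l j))\<^sup>2 + (of_int (Y' k l j))\<^sup>2)"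
    by (intro sum_mono abs_add_abs_le_squares)
  also have "\<dots> \<le> (\<Sum>k<K. \<Sum>l<K. 8 * real (card (B l k)))"
    using P by (intro sum_mono_2) simp
  also have "(\<Sum>k<K. \<Sum>l<K. 8 * real (card (B l k))) = 8 * real (card S)"
    by (subst sum.swap) (simp add: sum_distrib_left[symmetric] cS)
  also have "(\<Sum>k<K. \<Sum>l<K. 2 * R k l + 4 * real (card (B k l))) + 8 * real (card S)
      = 2 * frob_sq n M M' + 12 * real (card S)"
    by (simp add: sum.distrib sum_distrib_left[symmetric] R cS)
  finally have 3: "real_of_int (\<Sum>p\<in>S. size4 (q p)) \<le> 2 * frob_sq n M M' + 12 * real (card S)" by simp
  show ?thesis by (rule that[OF 1 3 2]) (simp add: q_def)
qed

section \<open>Summability of the lattice weights\<close>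

lemma sum_exp_abs_int_le:
  assumes "\<delta> > 0"
  shows "(\<Sum>x\<in>{- int N..int N}. exp (- \<delta> * real_of_int \<bar>x\<bar>)) \<le> 2 / (1 - exp (- \<delta>))"
proof -
  let ?r = "exp (- \<delta>)"
  have g: "(\<Sum>k\<le>N. ?r ^ k) \<le> 1 / (1 - ?r)"
    using geometric_sum_less[of ?r "{..N}"] assms by simp
  have e: "exp (- \<delta> * real k) = ?r ^ k" for k by (simp add: exp_of_nat_mult[symmetric] mult.commute)
  \<comment> \<open>Two copies of the geometric series, with zero counted twice, give the 2 in the
    bound.\<close>
  have "{- int N..int N} \<subseteq> int ` {..N} \<union> (\<lambda>k. - int k) ` {..N}"
  proof
    fix x assume x: "x \<in> {- int N..int N}"
    then have "x = int (nat x) \<and> nat x \<le> N \<or> x = - int (nat (- x)) \<and> nat (- x) \<le> N" by auto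
    then show "x \<in> int ` {..N} \<union> (\<lambda>k. - int k) ` {..N}" by blast
  qed
  then have "(\<Sum>x\<in>{- int N..int N}. exp (- \<delta> * real_of_int \<bar>x\<bar>))
     \<le> (\<Sum>x\<in>int ` {..N} \<union> (\<lambda>k. - int k) ` {..N}. exp (- \<delta> * real_of_int \<bar>x\<bar>))"
    by (intro sum_mono2) auto
  also have "\<dots> \<le> (\<Sum>x\<in>int ` {..N}. exp (- \<delta> * real_of_int \<bar>x\<bar>)) + (\<Sum>x\<in>(\<lambda>k. - int k) ` {..N}. exp (- \<delta> * real_of_int \<bar>x\<bar>))"
    by (subst sum.union_inter[symmetric]) (auto intro: sum_nonneg)
  also have "\<dots> = (\<Sum>k\<le>N. ?r ^ k) + (\<Sum>k\<le>N. ?r ^ k)"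
    by (simp add: sum.reindex inj_on_def e[symmetric])
  also have "\<dots> \<le> 2 / (1 - ?r)" using g by simp
  finally show ?thesis .
qed

text \<open>Finitely many codes lie in a common box, over which the sum factors by position and by
  coordinate; the bound does not depend on the box.\<close>

lemma sum_lattice_weights_le:
  assumes \<delta>: "\<delta> > 0" and S: "finite S" and F: "finite F" "F \<subseteq> extensional S"
  shows "(\<Sum>q\<in>F. exp (- \<delta> * real_of_int (\<Sum>p\<in>S. size4 (q p)))) \<le> ((2 / (1 - exp (- \<delta>))) ^ 4) ^ card S"
proof -
  \<comment> \<open>The inserted 0 keeps \<open>Max\<close> meaningful when there are no codes or no
    positions.\<close>
  define N where "N = nat (Max (insert 0 ((\<lambda>(q, p). size4 (q p)) ` (F \<times> S))))"
  let ?I = "{- int N..int N}"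
  let ?Q = "2 / (1 - exp (- \<delta>))"
  have size: "size4 (q p) \<le> int N" if "q \<in> F" "p \<in> S" for q p
  proof -
    have "size4 (q p) \<le> Max (insert 0 ((\<lambda>(q, p). size4 (q p)) ` (F \<times> S)))"
      using that F S by (intro Max_ge) force+
    then show ?thesis unfolding N_def by linarith
  qed
  have box: "q p \<in> ?I \<times> ?I \<times> ?I \<times> ?I" if "q \<in> F" "p \<in> S" for q p
    using size[OF that] by (cases "q p") (auto simp: size4_def)
  have FP: "F \<subseteq> PiE S (\<lambda>_. ?I \<times> ?I \<times> ?I \<times> ?I)"
    using box F(2) by (auto simp: PiE_def Pi_def)
  have one: "(\<Sum>x\<in>?I \<times> ?I \<times> ?I \<times> ?I. exp (- \<delta> * real_of_int (size4 x))) \<le> ?Q ^ 4"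
  proof -
    let ?f = "\<lambda>x. exp (- \<delta> * real_of_int \<bar>x\<bar>)"
    have "(\<Sum>x\<in>?I \<times> ?I \<times> ?I \<times> ?I. exp (- \<delta> * real_of_int (size4 x)))
        = (\<Sum>x\<in>?I \<times> ?I \<times> ?I \<times> ?I. case x of (a, b, c, d) \<Rightarrow> ?f a * (?f b * (?f c * ?f d)))"
      by (intro sum.cong refl) (auto simp: size4_def exp_add[symmetric] algebra_simps)
    also have "\<dots> = (\<Sum>a\<in>?I. \<Sum>b\<in>?I. \<Sum>c\<in>?I. \<Sum>d\<in>?I. ?f a * (?f b * (?f c * ?f d)))"
      by (simp add: sum.cartesian_product)
    also have "\<dots> = (\<Sum>x\<in>?I. ?f x) ^ 4"
      by (simp only: sum_distrib_left[symmetric] sum_distrib_right[symmetric]) (simp add: power4_eq_xxxx mult.assoc)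
    also have "\<dots> \<le> ?Q ^ 4"
      by (intro power_mono sum_exp_abs_int_le \<delta> sum_nonneg) auto
    finally show ?thesis .
  qed
  have "(\<Sum>q\<in>F. exp (- \<delta> * real_of_int (\<Sum>p\<in>S. size4 (q p)))) = (\<Sum>q\<in>F. \<Prod>p\<in>S. exp (- \<delta> * real_of_int (size4 (q p))))"
    using S by (simp add: exp_sum[symmetric] sum_distrib_left)
  also have "\<dots> \<le> (\<Sum>q\<in>PiE S (\<lambda>_. ?I \<times> ?I \<times> ?I \<times> ?I). \<Prod>p\<in>S. exp (- \<delta> * real_of_int (size4 (q p))))"
    using S FP by (intro sum_mono2 finite_PiE prod_nonneg) auto
  also have "\<dots> = (\<Prod>p\<in>S. \<Sum>x\<in>?I \<times> ?I \<times> ?I \<times> ?I. exp (- \<delta> * real_of_int (size4 x)))"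
    by (rule prod_sum_PiE[symmetric]) (use S in auto)
  also have "\<dots> \<le> (\<Prod>p\<in>S. ?Q ^ 4)"
    by (intro prod_mono conjI sum_nonneg one) auto
  finally show ?thesis by simp
qed

subsection \<open>Structure of the minimisers\<close>

definition nonzero_positions :: "nat \<Rightarrow> candidate \<Rightarrow> (nat \<times> nat) set" where
  "nonzero_positions n c = (case c of (\<Theta>, z, J, K) \<Rightarrow> {(i, l). i < n \<and> l < K \<and> i \<in> J (z i) l})"

text \<open>Labels are cut down to the nodes, so that candidates differing only beyond
  \<open>n\<close> share a model and the labellings form a finite product set.\<close>

definition model :: "nat \<Rightarrow> candidate \<Rightarrow> nat \<times> (nat \<Rightarrow> nat) \<times> (nat \<times> nat) set" where
  "model n c = (case c of (\<Theta>, z, J, K) \<Rightarrow> (K, restrict z {..<n}, nonzero_positions n c))"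

lemma community_restrict [simp]: "community n (restrict z {..<n}) = community n z"
  by (auto simp: community_def fun_eq_iff)

lemma clustering_restrict [simp]: "clustering n K (restrict z {..<n}) = clustering n K z"
  by (simp add: clustering_def)

lemma pen_cong:
  assumes "\<And>k. community n z k = community n z' k"
    and "\<And>k l. k < K \<Longrightarrow> l < K \<Longrightarrow> J k l = J' k l"
  shows "pen is_sp \<beta>1 \<beta>2 n z K J = pen is_sp \<beta>1 \<beta>2 n z' K J'"
  using assms by (simp add: pen_def pen_s_def pen_ns_def card_family_def)

lemma pen_scale: "a * pen is_sp \<beta>1 \<beta>2 n z K J = pen is_sp (a * \<beta>1) (a * \<beta>2) n z K J"
  by (simp add: pen_def pen_s_def pen_ns_def algebra_simps)

lemma objective_eq:
  assumes "clustering n K z"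
  shows "objective is_sp \<beta>1 \<beta>2 n A (\<Theta>, z, J, K) = frob_sq n A \<Theta> + pen is_sp \<beta>1 \<beta>2 n z K J"
proof -
  have "frob_sq n A \<Theta> = (\<Sum>k<K. \<Sum>l<K. \<Sum>i\<in>community n z k. \<Sum>j\<in>community n z l. (A i j - \<Theta> i j)\<^sup>2)"
    unfolding frob_sq_def by (rule sum_blocks) (use assms in \<open>simp add: clustering_def\<close>)
  then show ?thesis by (simp add: objective_def)
qed

lemma feasible_blk:
  assumes "feasible n (\<Theta>, z, J, K)" "k < K" "l < K"
  shows "blk n z (nonzero_positions n (\<Theta>, z, J, K)) k l = J k l"
  using assms unfolding feasible_def sparsity_family_def
  by (fastforce simp: blk_def community_def nonzero_positions_def)

lemma feasible_low_rank:
  assumes f: "feasible n (\<Theta>, z, J, K)"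
  shows "low_rank n z (nonzero_positions n (\<Theta>, z, J, K)) \<Theta>"
proof -
  let ?S = "nonzero_positions n (\<Theta>, z, J, K)"
  have zK: "\<And>i. i < n \<Longrightarrow> z i < K" using f by (simp add: feasible_def clustering_def)
  have bc: "(\<forall>i\<in>community n z k. \<forall>j\<in>community n z l. \<Theta> i j \<noteq> 0 \<longleftrightarrow> i \<in> J k l \<and> j \<in> J l k)
      \<and> (\<exists>u v :: nat \<Rightarrow> real. \<forall>i\<in>community n z k. \<forall>j\<in>community n z l. \<Theta> i j = u i * v j)"
    if "k < K" "l < K" for k l
    using f that by (simp add: feasible_def block_constraint_def)
  then have sup: "\<Theta> i j \<noteq> 0 \<longleftrightarrow> i \<in> J k l \<and> j \<in> J l k"
    if "k < K" "l < K" "i \<in> community n z k" "j \<in> community n z l" for i j k l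
    using that by blast
  have "\<exists>u v. k < K \<longrightarrow> l < K \<longrightarrow> (\<forall>i\<in>community n z k. \<forall>j\<in>community n z l. \<Theta> i j = u i * v j)" for k l
    using bc by blast
  then obtain u v where uv: "\<And>k l i j. k < K \<Longrightarrow> l < K \<Longrightarrow> i \<in> community n z k \<Longrightarrow> j \<in> community n z l
      \<Longrightarrow> \<Theta> i j = u k l i * v k l j"
    by metis
  show ?thesis unfolding low_rank_def
  proof (rule exI[of _ "\<lambda>i l k. u k l i"], rule exI[of _ "\<lambda>j k l. v k l j"], intro allI impI)
    fix i j assume ij: "i < n" "j < n"
    have c: "i \<in> community n z (z i)" "j \<in> community n z (z j)" using ij by (auto simp: community_def)
    have S: "(i, z j) \<in> ?S \<longleftrightarrow> i \<in> J (z i) (z j)" "(j, z i) \<in> ?S \<longleftrightarrow> j \<in> J (z j) (z i)"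
      using ij zK by (auto simp: nonzero_positions_def)
    show "\<Theta> i j = (if (i, z j) \<in> ?S \<and> (j, z i) \<in> ?S then u (z i) (z j) i * v (z i) (z j) j else 0)"
      using uv[OF zK zK c] sup[OF zK zK c] ij S by auto
  qed
qed

lemma low_rank_restrict [simp]: "low_rank n (restrict z {..<n}) S M = low_rank n z S M"
  by (simp add: low_rank_def)

lemma blk_restrict [simp]: "blk n (restrict z {..<n}) S = blk n z S"
  by (auto simp: blk_def fun_eq_iff)

text \<open>Otherwise a better competitor exists: all offending supports are emptied at once and the
  blocks of two single-node communities are set to zero. This saves more penalty than it costs in
  fit.\<close>

lemma solution_reduced:
  assumes sol: "is_solution True \<beta>1 \<beta>2 n A (\<Theta>, z, J, K)" and \<beta>1: "2 \<le> \<beta>1"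
    and A: "\<And>i j. A i j = 0 \<or> A i j = 1" and kl: "k < K" "l < K" and ne: "J k l \<noteq> {}"
  shows "J l k \<noteq> {} \<and> \<not> (card (community n z k) = 1 \<and> card (community n z l) = 1)"
proof (rule ccontr)
  assume bad: "\<not> ?thesis"
  let ?n = "\<lambda>k. card (community n z k)"
  let ?drop = "\<lambda>k l. J l k = {} \<or> (?n k = 1 \<and> ?n l = 1)"
  define J' where "J' k l = (if ?drop k l then {} else J k l)" for k l
  \<comment> \<open>Only blocks of two single-node communities need a change: where
    \<open>J l k\<close> is empty, the support constraint already forces \<open>\<Theta>\<close> to
    vanish.\<close>
  define \<Theta>' where "\<Theta>' i j = (if ?n (z i) = 1 \<and> ?n (z j) = 1 then 0 else \<Theta> i j)" for i j
  have f: "feasible n (\<Theta>, z, J, K)" using sol by (simp add: is_solution_def)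
  then have cl: "clustering n K z" and sp: "\<And>k l. k < K \<Longrightarrow> l < K \<Longrightarrow> J k l \<subseteq> community n z k"
    and bc: "\<And>k l i j. k < K \<Longrightarrow> l < K \<Longrightarrow> i \<in> community n z k \<Longrightarrow> j \<in> community n z l
        \<Longrightarrow> \<Theta> i j \<noteq> 0 \<longleftrightarrow> i \<in> J k l \<and> j \<in> J l k"
    and r1: "\<And>k l. k < K \<Longrightarrow> l < K \<Longrightarrow> \<exists>u v :: nat \<Rightarrow> real. \<forall>i\<in>community n z k. \<forall>j\<in>community n z l. \<Theta> i j = u i * v j"
    by (auto simp: feasible_def sparsity_family_def block_constraint_def)
  have zc: "z i = k" if "i \<in> community n z k" for i k using that by (simp add: community_def)
  have f': "feasible n (\<Theta>', z, J', K)"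
  proof -
    have "block_constraint n z K J' \<Theta>'"
      unfolding block_constraint_def
    proof (intro allI impI conjI ballI)
      fix a b i j assume ab: "a < K" "b < K" and ij: "i \<in> community n z a" "j \<in> community n z b"
      show "\<Theta>' i j \<noteq> 0 \<longleftrightarrow> i \<in> J' a b \<and> j \<in> J' b a"
        using bc[OF ab ij] zc[OF ij(1)] zc[OF ij(2)] by (auto simp: \<Theta>'_def J'_def)
    next
      fix a b assume ab: "a < K" "b < K"
      show "\<exists>u v :: nat \<Rightarrow> real. \<forall>i\<in>community n z a. \<forall>j\<in>community n z b. \<Theta>' i j = u i * v j"
      proof (cases "?n a = 1 \<and> ?n b = 1")
        case True
        then show ?thesis by (intro exI[of _ "\<lambda>_. 0"]) (auto simp: \<Theta>'_def dest!: zc)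
      next
        case False
        obtain u v :: "nat \<Rightarrow> real" where "\<forall>i\<in>community n z a. \<forall>j\<in>community n z b. \<Theta> i j = u i * v j"
          using r1[OF ab] by blast
        then have "\<forall>i\<in>community n z a. \<forall>j\<in>community n z b. \<Theta>' i j = u i * v j"
          using False zc unfolding \<Theta>'_def by auto
        then show ?thesis by blast
      qed
    qed
    then show ?thesis using f by (auto simp: feasible_def sparsity_family_def J'_def)
  qed
  \<comment> \<open>The share of block \<open>(k, l)\<close> in the objective; the remainder depends
    on \<open>z\<close> and \<open>K\<close> only, which the competitor keeps.\<close>
  define e where "e \<Theta> J k l = (\<Sum>i\<in>community n z k. \<Sum>j\<in>community n z l. (A i j - \<Theta> i j)\<^sup>2)
      + \<beta>1 * xln (card (J k l)) (real (?n k) * exp 1)" for \<Theta> :: "nat \<Rightarrow> nat \<Rightarrow> real" and J :: "nat \<Rightarrow> nat \<Rightarrow> nat set" and k l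
  have obj: "objective True \<beta>1 \<beta>2 n A (\<Theta>, z, J, K) = (\<Sum>k<K. \<Sum>l<K. e \<Theta> J k l)
      + (\<beta>2 * real K * (\<Sum>k<K. ln (real (?n k))) + \<beta>2 * (real n * ln (real K) + ln (real n)))" for \<Theta> J
    by (simp add: objective_def pen_def pen_s_def e_def sum.distrib sum_distrib_left)
  \<comment> \<open>At least \<open>\<beta>1\<close>, hence 2, is saved in penalty, while the fit
    worsens by at most 1, the square of a zero-one entry fitted by 0.\<close>
  have less: "e \<Theta>' J' a b < e \<Theta> J a b" if ab: "a < K" "b < K" and d: "?drop a b" "J a b \<noteq> {}" for a b
  proof -
    have "finite (J a b)" using sp[OF ab] by (rule finite_subset) simp
    then have "1 \<le> real (card (J a b))" using d by (simp add: Suc_le_eq card_gt_0_iff)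
    also have "\<dots> \<le> xln (card (J a b)) (real (?n a) * exp 1)"
      using sp[OF ab] by (intro xln_ge card_mono) auto
    finally have "1 \<le> xln (card (J a b)) (real (?n a) * exp 1)" .
    then have "2 * 1 \<le> \<beta>1 * xln (card (J a b)) (real (?n a) * exp 1)"
      using \<beta>1 by (intro mult_mono) auto
    moreover have "(\<Sum>i\<in>community n z a. \<Sum>j\<in>community n z b. (A i j - \<Theta>' i j)\<^sup>2)
        \<le> (\<Sum>i\<in>community n z a. \<Sum>j\<in>community n z b. (A i j - \<Theta> i j)\<^sup>2) + 1"
    proof (cases "?n a = 1 \<and> ?n b = 1")
      case True
      then obtain i j where "community n z a = {i}" "community n z b = {j}" by (auto simp: card_1_singleton_iff)
      moreover then have "\<Theta>' i j = 0" using True zc[of i a] zc[of j b] by (simp add: \<Theta>'_def)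
      moreover have "(A i j)\<^sup>2 \<le> 1" using A[of i j] by auto
      ultimately show ?thesis by (simp add: add_increasing)
    next
      case False
      then have "\<Theta>' i j = \<Theta> i j" if "i \<in> community n z a" "j \<in> community n z b" for i j
        using that zc by (auto simp: \<Theta>'_def)
      then show ?thesis by simp
    qed
    moreover have "xln (card (J' a b)) c = 0" for c using d by (simp add: J'_def xln_def)
    ultimately show ?thesis by (simp add: e_def)
  qed
  have same: "e \<Theta>' J' a b = e \<Theta> J a b" if ab: "a < K" "b < K" and d: "\<not> (?drop a b \<and> J a b \<noteq> {})" for a b
  proof -
    have J': "J' a b = J a b" using d by (auto simp: J'_def)
    have "\<Theta>' i j = \<Theta> i j" if "i \<in> community n z a" "j \<in> community n z b" for i j
      using that zc d bc[OF ab that] by (auto simp: \<Theta>'_def)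
    then show ?thesis by (simp add: e_def J')
  qed
  have le: "e \<Theta>' J' a b \<le> e \<Theta> J a b" if "a < K" "b < K" for a b
    using less[OF that] same[OF that] by fastforce
  have drop: "?drop k l" using bad by auto
  have "(\<Sum>k<K. \<Sum>l<K. e \<Theta>' J' k l) < (\<Sum>k<K. \<Sum>l<K. e \<Theta> J k l)"
  proof (rule sum_strict_mono_ex1)
    show "\<forall>a\<in>{..<K}. (\<Sum>l<K. e \<Theta>' J' a l) \<le> (\<Sum>l<K. e \<Theta> J a l)" using le by (auto intro: sum_mono)
    have "(\<Sum>l<K. e \<Theta>' J' k l) < (\<Sum>l<K. e \<Theta> J k l)"
      using le kl less[OF kl drop ne] by (intro sum_strict_mono_ex1) auto
    then show "\<exists>a\<in>{..<K}. (\<Sum>l<K. e \<Theta>' J' a l) < (\<Sum>l<K. e \<Theta> J a l)" using kl by auto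
  qed simp
  then have "objective True \<beta>1 \<beta>2 n A (\<Theta>', z, J', K) < objective True \<beta>1 \<beta>2 n A (\<Theta>, z, J, K)"
    unfolding obj by simp
  then show False using sol f' unfolding is_solution_def by (meson not_less)
qed

text \<open>Rephrases feasibility and minimality through the model, so that estimates with the same
  model have the same labels and support pattern.\<close>

lemma solution_model:
  assumes sol: "is_solution is_sp \<beta>1 \<beta>2 n A c" and \<beta>1: "2 \<le> \<beta>1" and A: "\<And>i j. A i j = 0 \<or> A i j = 1"
    and m: "model n c = (K, z, S)"
  shows "K \<in> {1..n}" "z \<in> PiE {..<n} (\<lambda>_. {..<K})" "clustering n K z" "S \<subseteq> {..<n} \<times> {..<K}"
    "is_sp \<longrightarrow> reduced n z K S" "low_rank n z S (fst c)"
    "objective is_sp \<beta>1 \<beta>2 n A c = frob_sq n A (fst c) + pen is_sp \<beta>1 \<beta>2 n z K (blk n z S)"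
proof -
  obtain \<Theta> z' J where c: "c = (\<Theta>, z', J, K)" and z: "z = restrict z' {..<n}" and S: "S = nonzero_positions n c"
    using m by (cases c) (auto simp: model_def)
  have f: "feasible n (\<Theta>, z', J, K)" using sol by (simp add: is_solution_def c)
  note b = feasible_blk[OF f, folded c S]
  have cl: "clustering n K z'" using f by (simp add: feasible_def)
  show "K \<in> {1..n}" using f by (simp add: feasible_def)
  show "z \<in> PiE {..<n} (\<lambda>_. {..<K})" using cl by (auto simp: z clustering_def)
  show "clustering n K z" using cl by (simp add: z)
  show "S \<subseteq> {..<n} \<times> {..<K}" by (auto simp: S c nonzero_positions_def)
  show "low_rank n z S (fst c)" using feasible_low_rank[OF f] by (simp add: z S c)
  show "is_sp \<longrightarrow> reduced n z K S"
  proof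
    assume "is_sp"
    then have "is_solution True \<beta>1 \<beta>2 n A (\<Theta>, z', J, K)" using sol by (simp add: c)
    from solution_reduced[OF this \<beta>1 A]
    have "J l k \<noteq> {} \<and> \<not> (card (community n z' k) = 1 \<and> card (community n z' l) = 1)"
      if "k < K" "l < K" "J k l \<noteq> {}" for k l
      using that by blast
    then show "reduced n z K S" by (simp add: reduced_def z b)
  qed
  show "objective is_sp \<beta>1 \<beta>2 n A c = frob_sq n A (fst c) + pen is_sp \<beta>1 \<beta>2 n z K (blk n z S)"
    using pen_cong[where n = n and z = z' and z' = z and K = K and J = J and J' = "blk n z S"] b cl by (simp add: c objective_eq z)
qed

text \<open>Lets the truth compete in the minimisation. The factors of block \<open>(k, l)\<close>
  come from columns \<open>l\<close> and \<open>k\<close> of \<open>\<Lambda>\<close>, and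
  \<open>Ks\<close> is at most \<open>n\<close> because no community is empty.\<close>

lemma truth_feasible:
  assumes cl: "clustering n Ks zs" and n: "0 < n"
    and P: "\<And>i j. i < n \<Longrightarrow> j < n \<Longrightarrow> P i j = \<Lambda> i (zs j) * \<Lambda> j (zs i)"
  shows "feasible n (P, zs, Jstar n zs \<Lambda>, Ks)"
proof -
  have "zs 0 < Ks" using cl n by (simp add: clustering_def)
  then have "1 \<le> Ks" by simp
  moreover have "Ks \<le> n"
  proof -
    have "{..<Ks} \<subseteq> zs ` {..<n}" using cl by (auto simp: clustering_def community_def)
    then have "card {..<Ks} \<le> card {..<n}" by (meson card_image_le card_mono finite_imageI finite_lessThan order_trans)
    then show ?thesis by simp
  qed
  moreover have "block_constraint n zs Ks (Jstar n zs \<Lambda>) P"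
    unfolding block_constraint_def
  proof (intro allI impI conjI ballI)
    fix k l i j assume "i \<in> community n zs k" "j \<in> community n zs l"
    then show "P i j \<noteq> 0 \<longleftrightarrow> i \<in> Jstar n zs \<Lambda> k l \<and> j \<in> Jstar n zs \<Lambda> l k"
      by (auto simp: Jstar_def community_def P)
  next
    fix k l
    show "\<exists>u v :: nat \<Rightarrow> real. \<forall>i\<in>community n zs k. \<forall>j\<in>community n zs l. P i j = u i * v j"
      by (rule exI[of _ "\<lambda>i. \<Lambda> i l"], rule exI[of _ "\<lambda>j. \<Lambda> j k"]) (auto simp: community_def P)
  qed
  ultimately show ?thesis using cl by (auto simp: feasible_def sparsity_family_def Jstar_def)
qed

text \<open>Comparison with the truth, the fit being expanded around \<open>P\<close>; the common
  term \<open>frob_sq n A P\<close> cancels.\<close>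

lemma basic_inequality:
  assumes sol: "is_solution is_sp \<beta>1 \<beta>2 n A c" and \<beta>1: "2 \<le> \<beta>1" and A: "\<And>i j. A i j = 0 \<or> A i j = 1"
    and m: "model n c = (K, z, S)"
    and cl: "clustering n Ks zs"
    and P: "\<And>i j. i < n \<Longrightarrow> j < n \<Longrightarrow> P i j = \<Lambda> i (zs j) * \<Lambda> j (zs i)"
  shows "frob_sq n (fst c) P + pen is_sp \<beta>1 \<beta>2 n z K (blk n z S)
    \<le> 2 * (\<Sum>i<n. \<Sum>j<n. (A i j - P i j) * (fst c i j - P i j)) + pen is_sp \<beta>1 \<beta>2 n zs Ks (Jstar n zs \<Lambda>)"
proof -
  have n: "0 < n" using solution_model(1)[OF sol \<beta>1 A m] by simp
  have "frob_sq n A (fst c) + pen is_sp \<beta>1 \<beta>2 n z K (blk n z S) = objective is_sp \<beta>1 \<beta>2 n A c"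
    using solution_model(7)[OF sol \<beta>1 A m] by simp
  also have "\<dots> \<le> objective is_sp \<beta>1 \<beta>2 n A (P, zs, Jstar n zs \<Lambda>, Ks)"
    using sol truth_feasible[of n Ks zs P \<Lambda>] cl n P by (simp add: is_solution_def)
  also have "\<dots> = frob_sq n A P + pen is_sp \<beta>1 \<beta>2 n zs Ks (Jstar n zs \<Lambda>)"
    by (rule objective_eq[OF cl])
  finally have 1: "frob_sq n A (fst c) + pen is_sp \<beta>1 \<beta>2 n z K (blk n z S) \<le> \<dots>" .
  have "frob_sq n A (fst c) = (\<Sum>i<n. \<Sum>j<n. (A i j - P i j)\<^sup>2 + (fst c i j - P i j)\<^sup>2
      - 2 * ((A i j - P i j) * (fst c i j - P i j)))"
    unfolding frob_sq_def by (intro sum.cong refl) (simp add: power2_eq_square algebra_simps)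
  also have "\<dots> = frob_sq n A P + frob_sq n (fst c) P - 2 * (\<Sum>i<n. \<Sum>j<n. (A i j - P i j) * (fst c i j - P i j))"
    by (simp add: frob_sq_def sum.distrib sum_subtractf sum_distrib_left)
  finally show ?thesis using 1 by simp
qed

subsection \<open>The risk bound\<close>

lemma frob_sq_nonneg: "0 \<le> frob_sq n M N"
  unfolding frob_sq_def by (intro sum_nonneg) auto

lemma frob_sq_triangle: "frob_sq n M N \<le> 2 * frob_sq n M P + 2 * frob_sq n N P"
proof -
  have "frob_sq n M N \<le> (\<Sum>i<n. \<Sum>j<n. 2 * (M i j - P i j)\<^sup>2 + 2 * (N i j - P i j)\<^sup>2)"
    unfolding frob_sq_def
  proof (intro sum_mono)
    fix i j
    show "(M i j - N i j)\<^sup>2 \<le> 2 * (M i j - P i j)\<^sup>2 + 2 * (N i j - P i j)\<^sup>2"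
      using square_add_le[of "M i j - P i j" "P i j - N i j"] by (simp add: power2_commute)
  qed
  then show ?thesis by (simp add: frob_sq_def sum.distrib sum_distrib_left)
qed

lemma one_le_weight_constant:
  assumes "0 < \<delta>"
  shows "1 \<le> 2 / (1 - exp (- \<delta> :: real))"
proof -
  have "0 < 1 - exp (- \<delta>)" "1 - exp (- \<delta>) \<le> 2" using assms exp_gt_zero[of "- \<delta>"] by (simp, linarith)
  then show ?thesis by simp
qed

text \<open>The basic inequality is divided by 400 and the union bound is applied with a model and a
  lattice code as index. In \<open>c\<close>, the term \<open>4 * ln Q\<close> pays for the four
  coordinates of the code at each position of the support, and 1/1000 for the rounding slack; the
  added 2 is what \<open>sum_models_le\<close> needs, and the factor 400 undoes the
  division.\<close>

lemma loss_exp_moment: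
  fixes c Q :: real
  defines "Q \<equiv> 2 / (1 - exp (- (1/20000)))"
  defines "c \<equiv> 1/1000 + 4 * ln Q"
  assumes cl: "clustering n Ks zs"
    and \<Lambda>: "\<And>i l. i < n \<Longrightarrow> l < Ks \<Longrightarrow> 0 \<le> \<Lambda> i l \<and> \<Lambda> i l \<le> 1"
    and P: "\<And>i j. i < n \<Longrightarrow> j < n \<Longrightarrow> P i j = \<Lambda> i (zs j) * \<Lambda> j (zs i)"
    and sol: "\<And>A. A \<in> set_pmf (adj_pmf n P) \<Longrightarrow> is_solution is_sp (400 * (c + 2)) 400 n A (sel A)"
  shows "measure_pmf.expectation (adj_pmf n P) (\<lambda>A. exp (frob_sq n (fst (sel A)) P / 800
      - pen is_sp (400 * (c + 2)) 400 n zs Ks (Jstar n zs \<Lambda>) / 400)) \<le> 2"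
proof -
  define p where "p = adj_pmf n P"
  define \<beta> where "\<beta> = 400 * (c + 2)"
  define pens where "pens = pen is_sp \<beta> 400 n zs Ks (Jstar n zs \<Lambda>)"
  define X where "X A = frob_sq n (fst (sel A)) P" for A
  define mo where "mo A = model n (sel A)" for A
  have Q1: "1 \<le> Q" unfolding Q_def by (rule one_le_weight_constant) simp
  then have c0: "0 \<le> c" by (simp add: c_def)
  then have \<beta>: "2 \<le> \<beta>" by (simp add: \<beta>_def)
  have finp: "finite (set_pmf p)" unfolding p_def by (rule finite_set_adj_pmf)
  have vals: "\<And>i j. A i j = 0 \<or> A i j = 1" if "A \<in> set_pmf p" for A
    using that set_adj_pmf_values unfolding p_def by blast
  have sol': "is_solution is_sp \<beta> 400 n A (sel A)" if "A \<in> set_pmf p" for A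
    using sol that by (simp add: p_def \<beta>_def)
  note sm = solution_model[OF sol' \<beta> vals]
  \<comment> \<open>A minimiser for some outcome has \<open>K\<close> between 1 and
    \<open>n\<close>, so \<open>n\<close> is positive.\<close>
  obtain A1 where A1: "A1 \<in> set_pmf p" using set_pmf_not_empty[of p] by blast
  obtain K1 z1 S1 where "mo A1 = (K1, z1, S1)" by (cases "mo A1")
  then have n: "0 < n" using sm(1)[OF A1 A1] by (fastforce simp: mo_def)
  have zs: "\<And>i. i < n \<Longrightarrow> zs i < Ks" using cl by (simp add: clustering_def)

  \<comment> \<open>Among the outcomes with the same selected model, fix one whose estimate is closest to \<open>P\<close>:
    this gives a deterministic centre of the right rank and support.\<close>
  define ctr where "ctr m = fst (sel (arg_min_on X {A \<in> set_pmf p. mo A = m}))" for m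
  have ctr: "frob_sq n (ctr (mo A)) P \<le> X A" "\<exists>A'\<in>set_pmf p. mo A' = mo A \<and> ctr (mo A) = fst (sel A')"
    if A: "A \<in> set_pmf p" for A
  proof -
    let ?C = "{A' \<in> set_pmf p. mo A' = mo A}"
    have C: "finite ?C" "A \<in> ?C" using finp A by auto
    then have "?C \<noteq> {}" by blast
    from arg_min_if_finite(1)[OF C(1) this, of X] arg_min_least[OF C(1) this C(2), of X]
    show "frob_sq n (ctr (mo A)) P \<le> X A" "\<exists>A'\<in>set_pmf p. mo A' = mo A \<and> ctr (mo A) = fst (sel A')"
      by (auto simp: ctr_def X_def)
  qed
  \<comment> \<open>For a fixed index \<open>G\<close> is a deterministic matrix, and
    \<open>W\<close> is its noise term normalised to have exponential moment at most 1. The scale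
    1/200 is the noise coefficient 2 divided by 400.\<close>
  define G where "G = (\<lambda>((K, z, S), q) i j. lattice n z S q i j + ctr (K, z, S) i j - P i j)"
  define W where "W = (\<lambda>t A. (\<Sum>i<n. \<Sum>j<n. (A i j - P i j) * (G t i j / 200)) - (\<Sum>i<n. \<Sum>j<n. (G t i j / 200)\<^sup>2) / 4)"
  \<comment> \<open>The cost of an index: model penalty plus code size, less the multiple of
    \<open>card S\<close> consumed by the rounding errors.\<close>
  define w where "w = (\<lambda>((K, z, S), q). pen is_sp (c + 2) 1 n z K (blk n z S) - real (card S) / 1000
      + (1/20000) * real_of_int (\<Sum>x\<in>S. size4 (q x)))"
  have mgf: "measure_pmf.expectation p (\<lambda>A. exp (W t A)) \<le> 1" for t
  proof -
    let ?s = "(\<Sum>i<n. \<Sum>j<n. (G t i j / 200)\<^sup>2) / 4"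
    have "measure_pmf.expectation p (\<lambda>A. exp (\<Sum>i<n. \<Sum>j<n. (A i j - P i j) * (G t i j / 200))) \<le> exp ?s"
      unfolding p_def
    proof (rule adj_pmf_mgf)
      fix i j assume ij: "i < n" "j < n"
      show "0 \<le> P i j \<and> P i j \<le> 1" using \<Lambda> zs ij by (simp add: P mult_le_one)
      show "P i j = P j i" using ij by (simp add: P)
    qed
    then show ?thesis unfolding W_def by (simp add: exp_diff)
  qed
  have "\<exists>q. q \<in> extensional (snd (snd (mo A))) \<and>
      X A / 800 - pens / 400 \<le> W (mo A, q) A - w (mo A, q)" if A: "A \<in> set_pmf p" for A
  proof -
    obtain K z S where m: "mo A = (K, z, S)" by (cases "mo A")
    note sA = sm[OF A A m[unfolded mo_def]]
    let ?\<Theta> = "fst (sel A)" and ?C = "ctr (mo A)"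
    obtain A' where A': "A' \<in> set_pmf p" "mo A' = (K, z, S)" "?C = fst (sel A')"
      using ctr(2)[OF A] m by auto
    have zK: "\<And>i. i < n \<Longrightarrow> z i < K" using sA(3) by (simp add: clustering_def)
    have lrC: "low_rank n z S ?C" using sm(6)[OF A'(1) A'(1) A'(2)[unfolded mo_def]] A'(3) by simp
    obtain q where q: "(\<Sum>i<n. \<Sum>j<n. (A i j - P i j) * (?\<Theta> i j - ?C i j)) \<le> (\<Sum>i<n. \<Sum>j<n. (A i j - P i j) * lattice n z S q i j)"
      "real_of_int (\<Sum>x\<in>S. size4 (q x)) \<le> 2 * frob_sq n ?\<Theta> ?C + 12 * real (card S)"
      "(\<Sum>i<n. \<Sum>j<n. (lattice n z S q i j)\<^sup>2) \<le> 16 * frob_sq n ?\<Theta> ?C + 32 * real (card S)"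
      "q \<in> extensional S"
      by (rule lattice_round[OF zK sA(4) sA(6) lrC])
    let ?G = "G (mo A, q)"
    have G: "?G i j = lattice n z S q i j + (?C i j - P i j)" for i j by (simp add: G_def m)
    have C: "frob_sq n ?C P \<le> X A" by (rule ctr(1)[OF A])
    \<comment> \<open>The centre is at least as close to \<open>P\<close> as the estimate, so their
      distance is controlled by the loss itself.\<close>
    have F: "frob_sq n ?\<Theta> ?C \<le> 4 * X A"
      using frob_sq_triangle[of n ?\<Theta> ?C P] C by (simp add: X_def)
    have "(\<Sum>i<n. \<Sum>j<n. (?G i j)\<^sup>2) \<le> (\<Sum>i<n. \<Sum>j<n. 2 * (lattice n z S q i j)\<^sup>2 + 2 * (?C i j - P i j)\<^sup>2)"
      unfolding G by (intro sum_mono square_add_le)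
    also have "\<dots> = 2 * (\<Sum>i<n. \<Sum>j<n. (lattice n z S q i j)\<^sup>2) + 2 * frob_sq n ?C P"
      by (simp add: frob_sq_def sum.distrib sum_distrib_left)
    also have "\<dots> \<le> 130 * X A + 64 * real (card S)" using q(3) F C by simp
    finally have GG: "(\<Sum>i<n. \<Sum>j<n. (?G i j)\<^sup>2) \<le> 130 * X A + 64 * real (card S)" .
    have "(\<Sum>i<n. \<Sum>j<n. (A i j - P i j) * (?\<Theta> i j - P i j))
        = (\<Sum>i<n. \<Sum>j<n. (A i j - P i j) * (?\<Theta> i j - ?C i j)) + (\<Sum>i<n. \<Sum>j<n. (A i j - P i j) * (?C i j - P i j))"
      by (simp add: sum.distrib[symmetric] algebra_simps)
    also have "\<dots> \<le> (\<Sum>i<n. \<Sum>j<n. (A i j - P i j) * lattice n z S q i j) + (\<Sum>i<n. \<Sum>j<n. (A i j - P i j) * (?C i j - P i j))"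
      using q(1) by simp
    also have "\<dots> = (\<Sum>i<n. \<Sum>j<n. (A i j - P i j) * ?G i j)"
      by (simp only: G distrib_left sum.distrib)
    finally have lin: "(\<Sum>i<n. \<Sum>j<n. (A i j - P i j) * (?\<Theta> i j - P i j)) \<le> \<dots>" .
    have "X A + pen is_sp \<beta> 400 n z K (blk n z S)
        \<le> 2 * (\<Sum>i<n. \<Sum>j<n. (A i j - P i j) * (?\<Theta> i j - P i j)) + pens"
      unfolding X_def pens_def
      using basic_inequality[where n = n and P = P and \<Lambda> = \<Lambda> and zs = zs, OF sol'[OF A] \<beta> vals[OF A] m[unfolded mo_def] cl] P by simp
    moreover have "pen is_sp (c + 2) 1 n z K (blk n z S) = pen is_sp \<beta> 400 n z K (blk n z S) / 400"
      using pen_scale[of 400 is_sp "c + 2" 1 n z K "blk n z S"] unfolding \<beta>_def by simp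
    moreover have "W (mo A, q) A = (\<Sum>i<n. \<Sum>j<n. (A i j - P i j) * ?G i j) / 200 - (\<Sum>i<n. \<Sum>j<n. (?G i j)\<^sup>2) / 160000"
      by (simp add: W_def sum_divide_distrib power_divide)
    moreover have "w (mo A, q) = pen is_sp (c + 2) 1 n z K (blk n z S) - real (card S) / 1000
        + (1/20000) * real_of_int (\<Sum>x\<in>S. size4 (q x))"
      by (simp add: w_def m)
    \<comment> \<open>The loss has coefficient 1/400; the variance term takes 130/160000 and the
      code size 8/20000, which leaves more than 1/800. The multiples of \<open>card S\<close>,
      64/160000 and 12/20000, add up to 1/1000.\<close>
    ultimately have "X A / 800 - pens / 400 \<le> W (mo A, q) A - w (mo A, q)"
      using lin GG q(2) F frob_sq_nonneg[of n ?\<Theta> P, folded X_def] by linarith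
    then show ?thesis using q(4) m by auto
  qed
  then obtain q where qe: "\<And>A. A \<in> set_pmf p \<Longrightarrow> q A \<in> extensional (snd (snd (mo A)))"
    and qW: "\<And>A. A \<in> set_pmf p \<Longrightarrow> X A / 800 - pens / 400 \<le> W (mo A, q A) A - w (mo A, q A)"
    by metis
  define T where "T = mo ` set_pmf p"
  define F where "F m = {q A |A. A \<in> set_pmf p \<and> mo A = m}" for m
  have finT: "finite T" using finp by (simp add: T_def)
  have finF: "finite (F m)" for m
    by (rule finite_subset[of _ "q ` set_pmf p"]) (auto simp: F_def finp)
  have Tm: "K \<in> {1..n} \<and> z \<in> PiE {..<n} (\<lambda>_. {..<K}) \<and> clustering n K z
        \<and> S \<subseteq> {..<n} \<times> {..<K} \<and> (is_sp \<longrightarrow> reduced n z K S)" if T: "(K, z, S) \<in> T" for K z S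
  proof -
    obtain A where A: "A \<in> set_pmf p" "mo A = (K, z, S)" using T by (auto simp: T_def)
    show ?thesis using sm[OF A(1) A(1) A(2)[unfolded mo_def]] by blast
  qed
  have "measure_pmf.expectation p (\<lambda>A. exp (X A / 800 - pens / 400))
      \<le> (\<Sum>t\<in>(\<lambda>A. (mo A, q A)) ` set_pmf p. exp (- w t))"
    by (rule expectation_le_max_weights[OF finp qW mgf])
  also have "\<dots> \<le> (\<Sum>t\<in>Sigma T F. exp (- w t))"
    using finT finF by (intro sum_mono2 finite_SigmaI) (auto simp: T_def F_def)
  also have "\<dots> = (\<Sum>m\<in>T. \<Sum>q\<in>F m. exp (- w (m, q)))"
    using finT finF by (simp add: sum.Sigma split_def)
  \<comment> \<open>For a fixed model the code weights sum to at most
    \<open>Q ^ (4 * card S)\<close>, which joins the 1/1000 to form the exponent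
    \<open>c * card S\<close>.\<close>
  also have "\<dots> \<le> (\<Sum>(K, z, S)\<in>T. exp (c * real (card S) - pen is_sp (c + 2) 1 n z K (blk n z S)))"
  proof (rule sum_mono)
    fix m assume mT: "m \<in> T"
    obtain K z S where m: "m = (K, z, S)" by (cases m)
    have S: "finite S" using Tm[of K z S] mT m by (auto intro: finite_subset)
    have "F m \<subseteq> extensional S" using qe m unfolding F_def by fastforce
    then have "(\<Sum>q\<in>F m. exp (- (1/20000) * real_of_int (\<Sum>x\<in>S. size4 (q x)))) \<le> (Q ^ 4) ^ card S"
      unfolding Q_def using S finF by (intro sum_lattice_weights_le) auto
    also have "(Q ^ 4) ^ card S = exp (4 * ln Q * real (card S))"
      using Q1 by (simp add: power_mult[symmetric] exp_of_nat_mult[symmetric] powr_realpow[symmetric] powr_def mult_ac)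
    finally have le: "(\<Sum>q\<in>F m. exp (- (1/20000) * real_of_int (\<Sum>x\<in>S. size4 (q x)))) \<le> exp (4 * ln Q * real (card S))" .
    have "(\<Sum>q\<in>F m. exp (- w (m, q)))
        = (\<Sum>q\<in>F m. exp (real (card S) / 1000 - pen is_sp (c + 2) 1 n z K (blk n z S))
            * exp (- (1/20000) * real_of_int (\<Sum>x\<in>S. size4 (q x))))"
      by (simp add: w_def m exp_add[symmetric] algebra_simps)
    also have "\<dots> = exp (real (card S) / 1000 - pen is_sp (c + 2) 1 n z K (blk n z S))
            * (\<Sum>q\<in>F m. exp (- (1/20000) * real_of_int (\<Sum>x\<in>S. size4 (q x))))"
      by (rule sum_distrib_left[symmetric])
    also have "\<dots> \<le> exp (real (card S) / 1000 - pen is_sp (c + 2) 1 n z K (blk n z S)) * exp (4 * ln Q * real (card S))"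
      by (intro mult_left_mono le) simp
    also have "\<dots> = exp (c * real (card S) - pen is_sp (c + 2) 1 n z K (blk n z S))"
      by (simp add: exp_add[symmetric] c_def algebra_simps)
    finally show "(\<Sum>q\<in>F m. exp (- w (m, q)))
        \<le> (case m of (K, z, S) \<Rightarrow> exp (c * real (card S) - pen is_sp (c + 2) 1 n z K (blk n z S)))"
      by (simp add: m)
  qed
  also have "\<dots> \<le> 2" by (rule sum_models_le[OF c0 _ n Tm]) simp
  finally show ?thesis unfolding p_def X_def pens_def \<beta>_def .
qed

theorem theorem1:
  shows "\<exists>\<beta>1 \<beta>2 H0 C. \<beta>1 > 0 \<and> \<beta>2 > 0 \<and> H0 > 0 \<and> C > 0 \<and>
    (\<forall>(is_sp::bool) (n::nat) (Ks::nat) (zs::nat \<Rightarrow> nat) (\<Lambda>::nat \<Rightarrow> nat \<Rightarrow> real)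
       (Pstar::nat \<Rightarrow> nat \<Rightarrow> real) (sel::(nat \<Rightarrow> nat \<Rightarrow> real) \<Rightarrow> candidate).
      clustering n Ks zs
      \<and> (\<forall>i<n. \<forall>l<Ks. 0 \<le> \<Lambda> i l \<and> \<Lambda> i l \<le> 1)
      \<and> (\<forall>i<n. \<forall>j<n. Pstar i j = \<Lambda> i (zs j) * \<Lambda> j (zs i))
      \<and> (\<forall>A\<in>set_pmf (adj_pmf n Pstar). is_solution is_sp \<beta>1 \<beta>2 n A (sel A))
      \<longrightarrow>
      (\<forall>t::real. t > 0 \<longrightarrow>
         measure_pmf.prob (adj_pmf n Pstar)
           {A. frob_sq n (fst (sel A)) Pstar / (real n)\<^sup>2
               \<le> H0 * pen is_sp \<beta>1 \<beta>2 n zs Ks (Jstar n zs \<Lambda>) / (real n)\<^sup>2 + C * t / (real n)\<^sup>2}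
         \<ge> 1 - 3 * exp (- t))
      \<and> measure_pmf.expectation (adj_pmf n Pstar) (\<lambda>A. frob_sq n (fst (sel A)) Pstar) / (real n)\<^sup>2
         \<le> H0 * pen is_sp \<beta>1 \<beta>2 n zs Ks (Jstar n zs \<Lambda>) / (real n)\<^sup>2 + 3 * C / (real n)\<^sup>2)"
proof -
  define Q :: real where "Q = 2 / (1 - exp (- (1/20000)))"
  define c where "c = 1/1000 + 4 * ln Q"
  have "1 \<le> Q" unfolding Q_def by (rule one_le_weight_constant) simp
  then have "0 \<le> c" by (simp add: c_def)
  then have c0: "0 < 400 * (c + 2)" by simp
  show ?thesis
  \<comment> \<open>The values 2 for \<open>H0\<close> and 800 for \<open>C\<close> come from
    solving the exponent in \<open>loss_exp_moment\<close> for the loss.\<close>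
  proof (rule exI[of _ "400 * (c + 2)"], rule exI[of _ 400], rule exI[of _ 2], rule exI[of _ 800],
      intro conjI allI impI; (elim conjE)?)
    fix is_sp n Ks zs \<Lambda> P and sel :: "(nat \<Rightarrow> nat \<Rightarrow> real) \<Rightarrow> candidate"
    assume h: "clustering n Ks zs" "\<forall>i<n. \<forall>l<Ks. 0 \<le> \<Lambda> i l \<and> \<Lambda> i l \<le> (1::real)"
      "\<forall>i<n. \<forall>j<n. P i j = \<Lambda> i (zs j) * \<Lambda> j (zs i)"
      "\<forall>A\<in>set_pmf (adj_pmf n P). is_solution is_sp (400 * (c + 2)) 400 n A (sel A)"
    define p where "p = adj_pmf n P"
    define pens where "pens = pen is_sp (400 * (c + 2)) 400 n zs Ks (Jstar n zs \<Lambda>)"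
    define Y where "Y A = frob_sq n (fst (sel A)) P / 800 - pens / 400" for A
    have int: "integrable (measure_pmf p) f" for f :: "_ \<Rightarrow> real"
      unfolding p_def by (rule integrable_measure_pmf_finite[OF finite_set_adj_pmf])
    have E: "measure_pmf.expectation p (\<lambda>A. exp (Y A)) \<le> 2"
      unfolding p_def Y_def pens_def c_def Q_def
      by (rule loss_exp_moment[of n Ks zs \<Lambda> P is_sp sel]) (use h in \<open>auto simp: c_def Q_def\<close>)
    have X: "frob_sq n (fst (sel A)) P = 800 * Y A + 2 * pens" for A by (simp add: Y_def)
    {
      fix t :: real
      \<comment> \<open>Markov's inequality for \<open>exp (Y A)\<close>, whose mean is at most
        2.\<close>
      have "measure_pmf.prob p {A. exp t \<le> exp (Y A)} \<le> measure_pmf.expectation p (\<lambda>A. exp (Y A)) / exp t"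
        using integral_Markov_inequality_measure[OF int[of "\<lambda>A. exp (Y A)"], of UNIV "exp t"] by simp
      also have "\<dots> \<le> 3 * exp (- t)" using E by (simp add: exp_minus divide_simps)
      finally have "measure_pmf.prob p {A. t \<le> Y A} \<le> 3 * exp (- t)" by simp
      moreover have "measure_pmf.prob p (- {A. t \<le> Y A}) = 1 - measure_pmf.prob p {A. t \<le> Y A}"
        using measure_pmf.prob_compl[of "{A. t \<le> Y A}" p] by (simp add: Compl_eq_Diff_UNIV)
      moreover have "measure_pmf.prob p (- {A. t \<le> Y A}) \<le> measure_pmf.prob p
        {A. frob_sq n (fst (sel A)) P / (real n)\<^sup>2 \<le> 2 * pens / (real n)\<^sup>2 + 800 * t / (real n)\<^sup>2}"
        by (rule measure_pmf.finite_measure_mono)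
          (auto simp: X add_divide_distrib[symmetric] intro!: divide_right_mono)
      ultimately show "1 - 3 * exp (- t) \<le> measure_pmf.prob (adj_pmf n P)
        {A. frob_sq n (fst (sel A)) P / (real n)\<^sup>2
           \<le> 2 * pen is_sp (400 * (c + 2)) 400 n zs Ks (Jstar n zs \<Lambda>) / (real n)\<^sup>2 + 800 * t / (real n)\<^sup>2}"
        unfolding p_def pens_def by linarith
    }
    \<comment> \<open>The bound in mean needs only that \<open>1 + y\<close> is at most
      \<open>exp y\<close>.\<close>
    have "measure_pmf.expectation p (\<lambda>A. 1 + Y A) \<le> measure_pmf.expectation p (\<lambda>A. exp (Y A))"
      by (rule integral_mono[OF int int]) (rule exp_ge_add_one_self)
    then have "measure_pmf.expectation p Y \<le> 3" using E int by simp
    then have "measure_pmf.expectation p (\<lambda>A. frob_sq n (fst (sel A)) P) \<le> 2 * pens + 3 * 800"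
      unfolding X using int by simp
    then show "measure_pmf.expectation (adj_pmf n P) (\<lambda>A. frob_sq n (fst (sel A)) P) / (real n)\<^sup>2
         \<le> 2 * pen is_sp (400 * (c + 2)) 400 n zs Ks (Jstar n zs \<Lambda>) / (real n)\<^sup>2 + 3 * 800 / (real n)\<^sup>2"
      unfolding p_def pens_def add_divide_distrib[symmetric] by (intro divide_right_mono) simp_all
  qed (use c0 in auto)
qed

end
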